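(* Let $T$ be a complete first-order theory in a countable language. If $T$ has a quasiminimal model of cardinality $\beth_{\omega_1}$, then $T$ has quasiminimal models of arbitrarily large cardinalities.
   Context: A structure is quasiminimal if it is uncountable and every subset of it definable (with parameters) by a first-order formula is either countable or has countable complement. *)

theory Defs
  imports Main "HOL-Library.Countable_Set"
begin

unbundle cardinal_syntax

section \<open>First-order logic with equality\<close>

record ('f, 'r) language =
  funs :: "'f set"
  rels :: "'r set"
  farity :: "'f \<Rightarrow> nat"
  rarity :: "'r \<Rightarrow> nat"

text \<open>Constants are function symbols of arity 0.\<close>

definition countable_language :: "('f, 'r) language \<Rightarrow> bool" where
  "countable_language L \<longleftrightarrow> countable (funs L) \<and> countable (rels L)"

datatype 'f fterm =
    Var nat
  | Fun 'f "'f fterm list"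

datatype ('f, 'r) form =
    Falsum
  | Eq "'f fterm" "'f fterm"
  | Rel 'r "'f fterm list"
  | Imp "('f, 'r) form" "('f, 'r) form"
  | Forall nat "('f, 'r) form"

abbreviation Neg :: "('f, 'r) form \<Rightarrow> ('f, 'r) form" where
  "Neg \<phi> \<equiv> Imp \<phi> Falsum"

fun wf_term :: "('f, 'r) language \<Rightarrow> 'f fterm \<Rightarrow> bool" where
  "wf_term L (Var x) \<longleftrightarrow> True"
| "wf_term L (Fun f ts) \<longleftrightarrow>
     f \<in> funs L \<and> length ts = farity L f \<and> (\<forall>t\<in>set ts. wf_term L t)"

fun wf_form :: "('f, 'r) language \<Rightarrow> ('f, 'r) form \<Rightarrow> bool" where
  "wf_form L Falsum \<longleftrightarrow> True"
| "wf_form L (Eq s t) \<longleftrightarrow> wf_term L s \<and> wf_term L t"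
| "wf_form L (Rel R ts) \<longleftrightarrow>
     R \<in> rels L \<and> length ts = rarity L R \<and> (\<forall>t\<in>set ts. wf_term L t)"
| "wf_form L (Imp \<phi> \<psi>) \<longleftrightarrow> wf_form L \<phi> \<and> wf_form L \<psi>"
| "wf_form L (Forall x \<phi>) \<longleftrightarrow> wf_form L \<phi>"

fun tvars :: "'f fterm \<Rightarrow> nat set" where
  "tvars (Var x) = {x}"
| "tvars (Fun f ts) = (\<Union>t\<in>set ts. tvars t)"

fun fvars :: "('f, 'r) form \<Rightarrow> nat set" where
  "fvars Falsum = {}"
| "fvars (Eq s t) = tvars s \<union> tvars t"
| "fvars (Rel R ts) = (\<Union>t\<in>set ts. tvars t)"
| "fvars (Imp \<phi> \<psi>) = fvars \<phi> \<union> fvars \<psi>"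
| "fvars (Forall x \<phi>) = fvars \<phi> - {x}"

definition is_sentence :: "('f, 'r) language \<Rightarrow> ('f, 'r) form \<Rightarrow> bool" where
  "is_sentence L \<phi> \<longleftrightarrow> wf_form L \<phi> \<and> fvars \<phi> = {}"

record ('f, 'r, 'a) struct =
  univ :: "'a set"
  fint :: "'f \<Rightarrow> 'a list \<Rightarrow> 'a"
  rint :: "'r \<Rightarrow> 'a list \<Rightarrow> bool"

text \<open>
  The values of \<open>fint\<close> and \<open>rint\<close> outside the symbols of the language, or on
  lists of the wrong length or not over the universe, are irrelevant.
\<close>

definition is_structure :: "('f, 'r) language \<Rightarrow> ('f, 'r, 'a) struct \<Rightarrow> bool" where
  "is_structure L M \<longleftrightarrow>
     univ M \<noteq> {} \<and>
     (\<forall>f\<in>funs L. \<forall>as. set as \<subseteq> univ M \<and> length as = farity L f \<longrightarrow> fint M f as \<in> univ M)"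

fun tval :: "('f, 'r, 'a) struct \<Rightarrow> (nat \<Rightarrow> 'a) \<Rightarrow> 'f fterm \<Rightarrow> 'a" where
  "tval M e (Var x) = e x"
| "tval M e (Fun f ts) = fint M f (map (tval M e) ts)"

fun sat :: "('f, 'r, 'a) struct \<Rightarrow> (nat \<Rightarrow> 'a) \<Rightarrow> ('f, 'r) form \<Rightarrow> bool" where
  "sat M e Falsum \<longleftrightarrow> False"
| "sat M e (Eq s t) \<longleftrightarrow> tval M e s = tval M e t"
| "sat M e (Rel R ts) \<longleftrightarrow> rint M R (map (tval M e) ts)"
| "sat M e (Imp \<phi> \<psi>) \<longleftrightarrow> (sat M e \<phi> \<longrightarrow> sat M e \<psi>)"
| "sat M e (Forall x \<phi>) \<longleftrightarrow> (\<forall>a\<in>univ M. sat M (e(x := a)) \<phi>)"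

definition holds :: "('f, 'r, 'a) struct \<Rightarrow> ('f, 'r) form \<Rightarrow> bool" where
  "holds M \<phi> \<longleftrightarrow> (\<forall>e. range e \<subseteq> univ M \<longrightarrow> sat M e \<phi>)"

definition is_theory :: "('f, 'r) language \<Rightarrow> ('f, 'r) form set \<Rightarrow> bool" where
  "is_theory L T \<longleftrightarrow> (\<forall>\<phi>\<in>T. is_sentence L \<phi>)"

definition is_model ::
  "('f, 'r) language \<Rightarrow> ('f, 'r) form set \<Rightarrow> ('f, 'r, 'a) struct \<Rightarrow> bool" where
  "is_model L T M \<longleftrightarrow> is_structure L M \<and> (\<forall>\<phi>\<in>T. holds M \<phi>)"

text \<open>
  HOL cannot quantify over the structures of all types inside a formula, so
  semantic consequence and completeness take the type \<open>'u\<close> of the elements of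
  the structures as a parameter.  For a countable language and an infinite type
  \<open>'u\<close> they do not depend on \<open>'u\<close>: by the Loewenheim-Skolem theorem every
  satisfiable theory has a model that is countable, hence one whose universe is
  a set of elements of \<open>'u\<close>.
\<close>

definition entails ::
  "'u itself \<Rightarrow> ('f, 'r) language \<Rightarrow> ('f, 'r) form set \<Rightarrow> ('f, 'r) form \<Rightarrow> bool" where
  "entails (_ :: 'u itself) L T \<phi> \<longleftrightarrow>
     (\<forall>M :: ('f, 'r, 'u) struct. is_model L T M \<longrightarrow> holds M \<phi>)"

definition complete_theory ::
  "'u itself \<Rightarrow> ('f, 'r) language \<Rightarrow> ('f, 'r) form set \<Rightarrow> bool" where
  "complete_theory (U :: 'u itself) L T \<longleftrightarrow>
     is_theory L T \<and>
     (\<exists>M :: ('f, 'r, 'u) struct. is_model L T M) \<and>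
     (\<forall>\<phi>. is_sentence L \<phi> \<longrightarrow> entails U L T \<phi> \<or> entails U L T (Neg \<phi>))"

section \<open>Quasiminimal structures\<close>

text \<open>
  The assignment \<open>e\<close> supplies the parameters: its values at the free variables
  of \<open>\<phi>\<close> other than \<open>x\<close>.
\<close>

definition definable_subset ::
  "('f, 'r) language \<Rightarrow> ('f, 'r, 'a) struct \<Rightarrow> 'a set \<Rightarrow> bool" where
  "definable_subset L M X \<longleftrightarrow>
     (\<exists>\<phi> x e. wf_form L \<phi> \<and> range e \<subseteq> univ M \<and> X = {a \<in> univ M. sat M (e(x := a)) \<phi>})"

definition quasiminimal :: "('f, 'r) language \<Rightarrow> ('f, 'r, 'a) struct \<Rightarrow> bool" where
  "quasiminimal L M \<longleftrightarrow>
     is_structure L M \<and>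
     \<not> countable (univ M) \<and>
     (\<forall>X. definable_subset L M X \<longrightarrow> countable X \<or> countable (univ M - X))"

section \<open>Beth cardinals\<close>

text \<open>
  Ordinals are represented by well-orders and cardinals by sets.  If \<open>I\<close> is the
  set of elements of \<open>r\<close> below some point (or the whole field) and \<open>B i\<close> has
  cardinality beth of the position of \<open>i\<close> for all \<open>i \<in> I\<close>, then \<open>beth_step r I B A\<close>
  says that \<open>A\<close> has cardinality beth of the order type of \<open>I\<close>.  The three clauses
  are beth(0) = aleph(0), beth(\<alpha> + 1) = 2^beth(\<alpha>), and, at a limit, the supremum
  (the least cardinal that is an upper bound).
\<close>

definition beth_step :: "'i rel \<Rightarrow> 'i set \<Rightarrow> ('i \<Rightarrow> 'a set) \<Rightarrow> 'a set \<Rightarrow> bool" where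
  "beth_step r I B A \<longleftrightarrow>
     (if I = {} then |A| =o natLeq
      else if \<exists>m\<in>I. \<forall>i\<in>I. (i, m) \<in> r
      then \<forall>m\<in>I. (\<forall>i\<in>I. (i, m) \<in> r) \<longrightarrow> |A| =o |Pow (B m)|
      else (\<forall>i\<in>I. |B i| \<le>o |A| ) \<and>
           (\<forall>C :: 'a set. (\<forall>i\<in>I. |B i| \<le>o |C| ) \<longrightarrow> |A| \<le>o |C| ))"

text \<open>
  \<open>A\<close> has cardinality beth of the order type of the well-order \<open>r\<close>.  All smaller
  beth cardinals are cardinalities of subsets of \<open>A\<close>, so it is no restriction to
  take the sets \<open>B i\<close> in the type of \<open>A\<close>.
\<close>

definition has_card_beth :: "'i rel \<Rightarrow> 'a set \<Rightarrow> bool" where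
  "has_card_beth r A \<longleftrightarrow>
     (\<exists>B :: 'i \<Rightarrow> 'a set.
        (\<forall>i\<in>Field r. beth_step r (underS r i) B (B i)) \<and> beth_step r (Field r) B A)"

definition omega1 :: "nat set rel" where
  "omega1 = cardSuc natLeq"

end

theory Submission
  imports Defs "HOL-Library.Countable_Set_Type"
begin

text \<open>
  This is Morley's computation of the Hanf number, applied to the type that a quasiminimal model
  has to omit: a new element of a countable definable set.  Choose Skolem functions for \<open>M\<close> and,
  for every formula, functions that enumerate its solution set whenever this set is countable.  By
  the Erdos-Rado theorem and a pigeonhole argument over \<open>\<omega>\<^sub>1\<close>, the size \<open>beth(\<omega>\<^sub>1)\<close> of \<open>M\<close> yields
  for every countable family of colourings of finite sequences with countably many colours a choice
  of one colour for each of them, such that any finitely many of the colourings have arbitrarily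
  long common homogeneous sequences with the chosen colours.  So \<open>M\<close> has a limit generated by an
  indiscernible sequence of any given length.  The index of an element in the enumeration of a
  countable solution set is one of the colours, hence constant along the limit, so that the limit
  has no new elements in these sets.
\<close>

section \<open>Homogeneous sets for colourings of increasing sequences\<close>

lemma card_of_Pow_mono:
  assumes "|A| \<le>o |B|"
  shows "|Pow A| \<le>o |Pow B|"
proof -
  obtain g where g: "inj_on g A" "g ` A \<subseteq> B"
    using assms card_of_ordLeq by metis
  have "inj_on ((`) g) (Pow A)"
    using g(1) by (rule inj_on_image_Pow)
  moreover have "(`) g ` Pow A \<subseteq> Pow B"
    using g(2) by auto
  ultimately show ?thesis
    using card_of_ordLeq by blast
qed

text \<open>An infinite set absorbs a product with a set no larger than itself, so by induction
  there are at most \<open>|A|\<close> lists of each length, and the countably many lengths add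
  nothing.\<close>

lemma card_of_lists_le:
  assumes "infinite A"
  shows "|lists A| \<le>o |A|"
proof -
  have len: "|{xs \<in> lists A. length xs = n}| \<le>o |A|" for n
  proof (induction n)
    case 0
    obtain a where "a \<in> A"
      using assms by fastforce
    then have "|{[] :: 'a list}| \<le>o |A|"
      by (metis card_of_singl_ordLeq empty_iff)
    moreover have "{xs \<in> lists A. length xs = 0} = {[]}"
      by auto
    ultimately show ?case
      by simp
  next
    case (Suc n)
    have "{xs \<in> lists A. length xs = Suc n}
        \<subseteq> (\<lambda>(a, xs). a # xs) ` (A \<times> {xs \<in> lists A. length xs = n})"
      by (auto simp: length_Suc_conv image_iff)
    then have "|{xs \<in> lists A. length xs = Suc n}| \<le>o |A \<times> {xs \<in> lists A. length xs = n}|"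
      by (meson card_of_image card_of_mono1 ordLeq_transitive)
    also have "|A \<times> {xs \<in> lists A. length xs = n}| \<le>o |A|"
      by (rule card_of_Sigma_ordLeq_infinite)
        (use assms Suc.IH ordLeq_refl[OF card_of_Card_order] in auto)
    finally show ?case .
  qed
  have "lists A = (\<Union>n\<in>(UNIV :: nat set). {xs \<in> lists A. length xs = n})"
    by auto
  moreover have "|\<Union>n\<in>(UNIV :: nat set). {xs \<in> lists A. length xs = n}| \<le>o |A|"
    using assms len infinite_iff_card_of_nat by (intro card_of_UNION_ordLeq_infinite) auto
  ultimately show ?thesis
    by simp
qed

section \<open>End-homogeneous sets and the Erdos-Rado theorem\<close>

abbreviation increasing :: "'a rel \<Rightarrow> 'a list \<Rightarrow> bool" where
  "increasing R \<equiv> sorted_wrt (\<lambda>x y. (x, y) \<in> R)"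

text \<open>
  For \<open>a \<in> A\<close> one defines by recursion along a well-order of \<open>\<Lambda>\<close> elements \<open>s a w\<close>, each the
  least one that is new and that \<open>f\<close> cannot distinguish from \<open>a\<close> over the earlier ones.  If the
  recursion never reaches \<open>a\<close>, the \<open>s a w\<close> form the required set.  It cannot reach every \<open>a\<close>,
  because \<open>s a\<close> depends only on the colours \<open>f (map (s a) us @ [a])\<close>, so that there would be at
  most \<open>2 ^ |\<Lambda>|\<close> many \<open>a\<close>.
\<close>

lemma end_homogeneous_subset:
  fixes R :: "'a rel" and f :: "'a list \<Rightarrow> nat" and \<Lambda> :: "'b set"
  assumes R: "wf R" "total R"
    and inf: "infinite \<Lambda>" and big: "|Pow (Pow \<Lambda>)| \<le>o |A|"
  obtains B where "B \<subseteq> A" "|\<Lambda>| \<le>o |B|"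
    "\<And>xs b c. set xs \<subseteq> B \<Longrightarrow> b \<in> B \<Longrightarrow> c \<in> B \<Longrightarrow>
      \<forall>x\<in>set xs. (x, b) \<in> R \<and> (x, c) \<in> R \<Longrightarrow> f (xs @ [b]) = f (xs @ [c])"
proof -
  define S where "S = |\<Lambda>| - Id"
  interpret W: wo_rel "|\<Lambda>|"
    by (simp add: wo_rel_def card_of_Well_order)
  have wfS: "wf S"
    unfolding S_def by (rule W.WF)
  have S_sub: "u \<in> \<Lambda> \<and> w \<in> \<Lambda>" if "(u, w) \<in> S" for u w
    using that by (metis DiffD1 FieldI1 FieldI2 Field_card_of S_def)
  have S_trans: "(u, w) \<in> S" if "(u, v) \<in> S" "(v, w) \<in> S" for u v w
    using that W.TRANS W.ANTISYM unfolding S_def trans_def antisym_def by blast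
  have S_total: "u = w \<or> (u, w) \<in> S \<or> (w, u) \<in> S" if "u \<in> \<Lambda>" "w \<in> \<Lambda>" for u w
    using that W.TOTALS by (auto simp: S_def Field_card_of)
  define P where "P a g w b \<longleftrightarrow> b \<in> A \<and> b \<notin> g ` {u. (u, w) \<in> S} \<and>
      (\<forall>us. set us \<subseteq> {u. (u, w) \<in> S} \<longrightarrow> f (map g us @ [b]) = f (map g us @ [a]))"
    for a and g :: "'b \<Rightarrow> 'a" and w b
  define least where "least Q = (SOME b. Q b \<and> (\<forall>c. Q c \<longrightarrow> (c, b) \<notin> R))" for Q :: "'a \<Rightarrow> bool"
  have least: "Q (least Q) \<and> (\<forall>c. Q c \<longrightarrow> (c, least Q) \<notin> R)" if "Q b" for Q b
  proof -
    have "\<exists>c\<in>Collect Q. \<forall>y. (y, c) \<in> R \<longrightarrow> y \<notin> Collect Q"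
      using R(1) that unfolding wf_eq_minimal by blast
    then have "\<exists>b. Q b \<and> (\<forall>c. Q c \<longrightarrow> (c, b) \<notin> R)"
      by blast
    then show ?thesis
      unfolding least_def by (rule someI_ex)
  qed
  define s where "s a = wfrec S (\<lambda>g w. least (P a g w))" for a
  have P_cong: "P a g w = P a h w" if eq: "\<And>u. (u, w) \<in> S \<Longrightarrow> g u = h u" for a g h w
  proof -
    have "map g us = map h us" if "set us \<subseteq> {u. (u, w) \<in> S}" for us
      using that eq by (intro map_cong) auto
    moreover have "g ` {u. (u, w) \<in> S} = h ` {u. (u, w) \<in> S}"
      using eq by (intro image_cong) auto
    ultimately show ?thesis
      unfolding P_def by (intro ext) (metis (no_types, lifting))
  qed
  have s_eq: "s a w = least (P a (s a) w)" for a w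
  proof -
    have "s a w = least (P a (cut (s a) S w) w)"
      unfolding s_def using wfrec[OF wfS] .
    then show ?thesis
      using P_cong[of w "cut (s a) S w" "s a"] by (simp add: cut_def)
  qed
  show thesis
  proof (cases "\<exists>a\<in>A. \<forall>w\<in>\<Lambda>. s a w \<noteq> a")
    case True
    then obtain a where a: "a \<in> A" and ne: "\<And>w. w \<in> \<Lambda> \<Longrightarrow> s a w \<noteq> a"
      by blast
    \<comment> \<open>Never reached by the recursion, \<open>a\<close> itself is a candidate at
      every stage, so \<open>least\<close> always has something to choose from.\<close>
    have cand: "P a (s a) w a" for w
      using a ne S_sub unfolding P_def by (metis (mono_tags, lifting) imageE mem_Collect_eq)
    have Ps: "P a (s a) w (s a w)" for w
      using least[of "P a (s a) w", OF cand] s_eq by metis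
    have mini: "(c, s a w) \<notin> R" if "P a (s a) w c" for c w
      using least[of "P a (s a) w", OF cand] s_eq that by metis
    \<comment> \<open>A candidate at \<open>w\<close> is also one at every earlier \<open>u\<close>,
      so it cannot lie below the minimal choice at \<open>u\<close>.\<close>
    have incr: "(s a u, s a w) \<in> R" if "(u, w) \<in> S" for u w
    proof -
      have "P a (s a) u (s a w)"
        using Ps[of w] S_trans that unfolding P_def by blast
      then have "(s a w, s a u) \<notin> R"
        by (rule mini)
      moreover have "s a w \<noteq> s a u"
        using Ps[of w] that unfolding P_def by blast
      ultimately show ?thesis
        using R(2) by (meson UNIV_I total_on_def)
    qed
    have asym: "(y, x) \<notin> R" if "(x, y) \<in> R" for x y
      using R(1) that by (meson wf_not_sym)
    have S_if_R: "(u, w) \<in> S" if "(s a u, s a w) \<in> R" "u \<in> \<Lambda>" "w \<in> \<Lambda>" for u w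
      using that S_total incr asym by metis
    have "inj_on (s a) \<Lambda>"
      using S_total incr asym by (metis inj_onI)
    then have "|\<Lambda>| \<le>o |s a ` \<Lambda>|"
      by (meson card_of_ordLeq subset_refl)
    moreover have "s a ` \<Lambda> \<subseteq> A"
      using Ps by (auto simp: P_def)
    moreover have "f (xs @ [b]) = f (xs @ [a])"
      if xs: "set xs \<subseteq> s a ` \<Lambda>" and b: "b \<in> s a ` \<Lambda>" and less: "\<forall>x\<in>set xs. (x, b) \<in> R" for xs b
    proof -
      obtain w where w: "w \<in> \<Lambda>" "b = s a w"
        using b by blast
      have "xs \<in> map (s a) ` lists \<Lambda>"
        using xs by (auto simp flip: lists_image)
      then obtain us where us: "set us \<subseteq> \<Lambda>" "xs = map (s a) us"
        by auto
      have "set us \<subseteq> {u. (u, w) \<in> S}"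
        using us w less S_if_R by auto
      then show ?thesis
        using Ps[of w] us w by (simp add: P_def)
    qed
    ultimately show thesis
      using that[of "s a ` \<Lambda>"] by metis
  next
    case False
    then obtain k where k: "\<And>a. a \<in> A \<Longrightarrow> k a \<in> \<Lambda> \<and> s a (k a) = a"
      by metis
    \<comment> \<open>The graph of the colours seen by \<open>a\<close> is a subset of
      \<open>lists \<Lambda> \<times> UNIV\<close>, a product of size at most
      \<open>|\<Lambda>|\<close>; so there are at most \<open>|Pow \<Lambda>|\<close> such
      graphs.\<close>
    define \<tau> where "\<tau> a = (\<lambda>us. (us, f (map (s a) us @ [a]))) ` lists \<Lambda>" for a
    have "inj_on (\<lambda>a. (\<tau> a, k a)) A"
    proof (rule inj_onI)
      fix a b
      assume ab: "a \<in> A" "b \<in> A" and "(\<tau> a, k a) = (\<tau> b, k b)"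
      then have \<tau>: "\<tau> a = \<tau> b" and kk: "k a = k b"
        by auto
      have col: "f (map (s a) us @ [a]) = f (map (s b) us @ [b])" if "us \<in> lists \<Lambda>" for us
      proof -
        have "(us, f (map (s a) us @ [a])) \<in> \<tau> b"
          using that \<tau> by (auto simp: \<tau>_def)
        then show ?thesis
          by (auto simp: \<tau>_def)
      qed
      have "s a w = s b w" for w
        using wfS
      proof (induction w rule: wf_induct_rule)
        case (less w)
        have "f (map (s a) us @ [a]) = f (map (s a) us @ [b])" if "set us \<subseteq> {u. (u, w) \<in> S}" for us
        proof -
          have "us \<in> lists \<Lambda>"
            using that S_sub by auto
          moreover have "map (s a) us = map (s b) us"
            using that less.IH by auto
          ultimately show ?thesis
            using col by metis
        qed
        then have "P a (s a) w = P b (s a) w"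
          unfolding P_def by (intro ext) auto
        then show ?case
          using s_eq P_cong[of w "s a" "s b"] less.IH by metis
      qed
      then show "a = b"
        using k ab kk by metis
    qed
    moreover have "(\<lambda>a. (\<tau> a, k a)) ` A \<subseteq> Pow (lists \<Lambda> \<times> (UNIV :: nat set)) \<times> \<Lambda>"
      using k by (auto simp: \<tau>_def)
    ultimately have A_le: "|A| \<le>o |Pow (lists \<Lambda> \<times> (UNIV :: nat set)) \<times> \<Lambda>|"
      using card_of_ordLeq by blast
    have "|lists \<Lambda> \<times> (UNIV :: nat set)| \<le>o |\<Lambda>|"
      using inf card_of_lists_le infinite_iff_card_of_nat[of \<Lambda>]
      by (intro card_of_Sigma_ordLeq_infinite) simp_all
    then have "|Pow (lists \<Lambda> \<times> (UNIV :: nat set))| \<le>o |Pow \<Lambda>|"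
      by (rule card_of_Pow_mono)
    moreover have "|\<Lambda>| \<le>o |Pow \<Lambda>|"
      using card_of_Pow ordLess_imp_ordLeq by blast
    ultimately have "|Pow (lists \<Lambda> \<times> (UNIV :: nat set)) \<times> \<Lambda>| \<le>o |Pow \<Lambda>|"
      using inf by (intro card_of_Sigma_ordLeq_infinite) simp_all
    with A_le have "|A| \<le>o |Pow \<Lambda>|"
      by (rule ordLeq_transitive)
    with big have "|Pow (Pow \<Lambda>)| \<le>o |Pow \<Lambda>|"
      by (rule ordLeq_transitive)
    then show thesis
      using not_ordLess_ordLeq[OF card_of_Pow] by metis
  qed
qed

text \<open>By induction on \<open>n\<close>. An end-homogeneous set costs two powersets, hence the
  index \<open>2 * n\<close>; on it the colour does not depend on which larger element comes last,
  so \<open>f\<close> induces a colouring of sequences shorter by one.\<close>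

lemma erdos_rado_nat_colouring:
  fixes R :: "'a rel" and D :: "nat \<Rightarrow> 'b set"
  assumes R: "wf R" "total R"
    and inf: "infinite (D 0)" and step: "\<And>k. |Pow (D k)| \<le>o |D (Suc k)|"
    and "|D (2 * n)| \<le>o |A|"
  shows "\<exists>B v. B \<subseteq> A \<and> |D 0| \<le>o |B| \<and>
    (\<forall>xs. set xs \<subseteq> B \<longrightarrow> length xs = n \<longrightarrow> increasing R xs \<longrightarrow> (f xs :: nat) = v)"
  using assms(5)
proof (induction n arbitrary: A f)
  case 0
  then show ?case
    by (intro exI[of _ A] exI[of _ "f []"]) auto
next
  case (Suc n)
  have mono: "|D k| \<le>o |D (Suc k)|" for k
    using step card_of_Pow ordLess_imp_ordLeq ordLeq_transitive by blast
  have infD: "infinite (D k)" for k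
    by (induction k) (use inf mono card_of_ordLeq_infinite in blast)+
  have "|Pow (Pow (D (2 * n)))| \<le>o |A|"
    using card_of_Pow_mono[OF step[of "2 * n"]] step[of "Suc (2 * n)"] Suc.prems
    by (metis mult_Suc_right add_2_eq_Suc ordLeq_transitive)
  then obtain B where B: "B \<subseteq> A" "|D (2 * n)| \<le>o |B|"
    and end_hom: "\<And>xs b c. set xs \<subseteq> B \<Longrightarrow> b \<in> B \<Longrightarrow> c \<in> B \<Longrightarrow>
      \<forall>x\<in>set xs. (x, b) \<in> R \<and> (x, c) \<in> R \<Longrightarrow> f (xs @ [b]) = f (xs @ [c])"
    using end_homogeneous_subset[OF R infD] by (metis (no_types))
  \<comment> \<open>For \<open>xs\<close> in \<open>B\<close>, end-homogeneity gives the same colour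
    for every element of \<open>B\<close> above \<open>xs\<close>, so the choice is immaterial
    whenever such an element exists.\<close>
  define g where "g xs = f (xs @ [SOME b. b \<in> B \<and> (\<forall>x\<in>set xs. (x, b) \<in> R)])" for xs
  obtain C v where C: "C \<subseteq> B" "|D 0| \<le>o |C|"
    and hom: "\<And>xs. set xs \<subseteq> C \<Longrightarrow> length xs = n \<Longrightarrow> increasing R xs \<Longrightarrow> g xs = v"
    using Suc.IH[OF B(2), of g] by blast
  have "f xs = v" if xs: "set xs \<subseteq> C" "length xs = Suc n" "increasing R xs" for xs
  proof -
    obtain ys b where xs_eq: "xs = ys @ [b]"
      using xs(2) by (metis length_Suc_conv_rev)
    have b: "b \<in> B \<and> (\<forall>x\<in>set ys. (x, b) \<in> R)"
      using xs C(1) by (auto simp: xs_eq sorted_wrt_append)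
    let ?c = "SOME b. b \<in> B \<and> (\<forall>x\<in>set ys. (x, b) \<in> R)"
    have c: "?c \<in> B \<and> (\<forall>x\<in>set ys. (x, ?c) \<in> R)"
      using someI[of "\<lambda>b. b \<in> B \<and> (\<forall>x\<in>set ys. (x, b) \<in> R)", OF b] .
    have "f xs = g ys"
      unfolding g_def xs_eq using b c xs(1) C(1)
      by (intro end_hom) (auto simp: xs_eq)
    also have "g ys = v"
      using xs by (intro hom) (auto simp: xs_eq sorted_wrt_append)
    finally show ?thesis .
  qed
  then show ?case
    using B C by blast
qed

section \<open>The first uncountable ordinal and the beth hierarchy below it\<close>

lemma Card_order_omega1: "Card_order omega1"
  unfolding omega1_def using natLeq_Card_order by (rule cardSuc_Card_order)

lemma Well_order_omega1: "Well_order omega1"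
  using Card_order_omega1 by (rule card_order_on_well_order_on)

interpretation omega1: wo_rel omega1
  by (simp add: wo_rel_def Well_order_omega1)

lemma natLeq_less_omega1: "natLeq <o omega1"
  unfolding omega1_def using natLeq_Card_order by (rule cardSuc_greater)

lemma uncountable_Field_omega1: "\<not> countable (Field omega1)"
proof
  assume "countable (Field omega1)"
  then have "|Field omega1| \<le>o natLeq"
    by (simp add: countable_card_le_natLeq)
  moreover have "omega1 =o |Field omega1|"
    using card_of_Field_ordIso[OF Card_order_omega1] by (rule ordIso_symmetric)
  ultimately have "omega1 \<le>o natLeq"
    by (rule ordIso_ordLeq_trans[rotated])
  then show False
    using natLeq_less_omega1 not_ordLess_ordLeq by metis
qed

lemma omega1_unbounded:
  assumes "i \<in> Field omega1"
  shows "\<exists>j\<in>Field omega1. (i, j) \<in> omega1 - Id"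
  using infinite_Card_order_limit[OF Card_order_omega1 _ assms] uncountable_Field_omega1
    countable_finite by blast

lemma countable_underS_omega1:
  assumes "i \<in> Field omega1"
  shows "countable (underS omega1 i)"
proof -
  have "|underS omega1 i| <o cardSuc natLeq"
    using card_of_underS[OF Card_order_omega1 assms] by (simp add: omega1_def)
  then show ?thesis
    using cardSuc_ordLeq_ordLess[OF natLeq_Card_order card_of_Card_order]
    unfolding countable_card_le_natLeq by blast
qed

text \<open>The cofinality is uncountable: an unbounded countable \<open>K\<close> would cover
  \<open>Field omega1\<close> by countably many countable initial segments.\<close>

lemma countable_bounded_omega1:
  assumes "countable K" "K \<subseteq> Field omega1"
  shows "\<exists>j\<in>Field omega1. \<forall>k\<in>K. (k, j) \<in> omega1"
proof (rule ccontr)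
  assume "\<not> ?thesis"
  then have "\<forall>j\<in>Field omega1. \<exists>k\<in>K. (k, j) \<notin> omega1"
    by blast
  then have "Field omega1 \<subseteq> (\<Union>k\<in>K. underS omega1 k)"
    using assms(2) omega1.TOTALS omega1.REFL
    by (auto simp: underS_def refl_on_def) (metis subsetD)
  moreover have "countable (\<Union>k\<in>K. underS omega1 k)"
    using assms countable_underS_omega1 by (intro countable_UN) auto
  ultimately show False
    using uncountable_Field_omega1 countable_subset by blast
qed

text \<open>Forgets the exact beth cardinals and keeps the growth that the Erdos-Rado theorem
  consumes: between two indices at least one powerset is gained. This follows by induction along the
  well-order, by cases on whether the predecessors have a last element.\<close>

lemma beth_chain:
  fixes A :: "'a set"
  assumes "has_card_beth omega1 A"
  shows "\<exists>B :: nat set \<Rightarrow> 'a set. (\<forall>i\<in>Field omega1. infinite (B i) \<and> |B i| \<le>o |A| ) \<and>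
    (\<forall>i j. (j, i) \<in> omega1 - Id \<longrightarrow> |Pow (B j)| \<le>o |B i| )"
proof -
  obtain B where step: "\<And>i. i \<in> Field omega1 \<Longrightarrow> beth_step omega1 (underS omega1 i) B (B i)"
    and last: "beth_step omega1 (Field omega1) B A"
    using assms by (auto simp: has_card_beth_def)
  have Pow_le: "|Pow (B j)| \<le>o |B i|" if "(j, i) \<in> omega1 - Id" for i j
    using that
  proof (induction i arbitrary: j rule: wf_induct_rule[OF omega1.WF])
    case (1 i)
    note IH = 1(1) and ji = 1(2)
    let ?I = "underS omega1 i"
    have i: "i \<in> Field omega1" and j: "j \<in> ?I" "j \<in> Field omega1"
      using ji by (auto simp: underS_def Field_def)
    show ?case
    proof (cases "\<exists>m\<in>?I. \<forall>k\<in>?I. (k, m) \<in> omega1")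
      case True
      then obtain m where m: "m \<in> ?I" "\<forall>k\<in>?I. (k, m) \<in> omega1"
        by blast
      have "|B i| =o |Pow (B m)|"
        using step[OF i] m j by (auto simp: beth_step_def split: if_splits)
      moreover have "|Pow (B j)| \<le>o |Pow (B m)|"
      proof (cases "j = m")
        case True
        then show ?thesis
          by (simp add: ordLeq_refl card_of_Card_order)
      next
        case False
        then have "|Pow (B j)| \<le>o |B m|"
          using m j by (intro IH) (auto simp: underS_def)
        then show ?thesis
          using card_of_Pow ordLess_imp_ordLeq ordLeq_transitive by blast
      qed
      ultimately show ?thesis
        by (meson ordIso_symmetric ordLeq_ordIso_trans)
    next
      \<comment> \<open>In the limit case some predecessor \<open>k\<close> of \<open>i\<close> lies
        strictly above \<open>j\<close>, and the powerset is already gained on the way to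
        \<open>k\<close>.\<close>
      case False
      then obtain k where k: "k \<in> ?I" "(k, j) \<notin> omega1"
        using j by blast
      then have "(j, k) \<in> omega1 - Id"
        using j omega1.TOTALS omega1.REFL by (auto simp: underS_def Field_def refl_on_def)
      then have "|Pow (B j)| \<le>o |B k|"
        using k by (intro IH) (auto simp: underS_def)
      moreover have "|B k| \<le>o |B i|"
        using step[OF i] False k by (auto simp: beth_step_def split: if_splits)
      ultimately show ?thesis
        by (rule ordLeq_transitive)
    qed
  qed
  have inf: "infinite (B i)" if "i \<in> Field omega1" for i
    using that
  proof (induction i rule: wf_induct_rule[OF omega1.WF])
    case (1 i)
    show ?case
    proof (cases "underS omega1 i = {}")
      case True
      then have "|B i| =o natLeq"
        using step[OF 1(2)] by (simp add: beth_step_def)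
      then show ?thesis
        by (metis Field_natLeq Field_card_of infinite_UNIV_nat card_of_ordIso_finite_Field
            natLeq_Card_order ordIso_symmetric)
    next
      case False
      then obtain j where j: "(j, i) \<in> omega1 - Id"
        by (auto simp: underS_def)
      then have "infinite (B j)"
        by (intro 1(1)) (auto simp: Field_def)
      then have "infinite (Pow (B j))"
        by simp
      then show ?thesis
        using Pow_le[OF j] card_of_ordLeq_infinite by blast
    qed
  qed
  \<comment> \<open>Without a last element in \<open>omega1\<close>, the supremum clause of
    \<open>beth_step\<close> applies to \<open>A\<close>.\<close>
  have "\<not> (\<exists>m\<in>Field omega1. \<forall>i\<in>Field omega1. (i, m) \<in> omega1)"
    using omega1_unbounded omega1.ANTISYM unfolding antisym_def by blast
  moreover have "Field omega1 \<noteq> {}"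
    using uncountable_Field_omega1 by auto
  ultimately have "|B i| \<le>o |A|" if "i \<in> Field omega1" for i
    using last that by (auto simp: beth_step_def)
  with inf Pow_le show ?thesis
    by blast
qed

section \<open>One colour for each of countably many colourings\<close>

text \<open>Only the colours are fixed once and for all; the homogeneous set may vary with
  \<open>K\<close>. The colours are chosen one after another so that \<open>good\<close> is
  preserved.\<close>

lemma homogeneous_template:
  fixes C :: "nat \<Rightarrow> 'a list \<Rightarrow> nat" and len :: "nat \<Rightarrow> nat" and M :: "'a set"
  assumes R: "wf R" "total R" and M: "has_card_beth omega1 M"
  obtains v where "\<And>K. \<exists>A\<subseteq>M. infinite A \<and> (\<forall>l<K. \<forall>xs. set xs \<subseteq> A \<longrightarrow> length xs = len l \<longrightarrow>
    increasing R xs \<longrightarrow> C l xs = v l)"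
proof -
  obtain B :: "nat set \<Rightarrow> 'a set" where B: "\<forall>i\<in>Field omega1. infinite (B i) \<and> |B i| \<le>o |M|"
    "\<forall>i j. (j, i) \<in> omega1 - Id \<longrightarrow> |Pow (B j)| \<le>o |B i|"
    using beth_chain[OF M] by blast
  have infB: "infinite (B i)" and B_le: "|B i| \<le>o |M|" if "i \<in> Field omega1" for i
    using B(1) that by auto
  have Pow_le: "|Pow (B j)| \<le>o |B i|" if "(j, i) \<in> omega1 - Id" for i j
    using B(2) that by blast
  have B_mono: "|B j| \<le>o |B i|" if "(j, i) \<in> omega1" for i j
  proof (cases "i = j")
    case True
    then show ?thesis
      by (simp add: ordLeq_refl card_of_Card_order)
  next
    case False
    then have "|Pow (B j)| \<le>o |B i|"
      using that by (intro Pow_le) auto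
    then show ?thesis
      using card_of_Pow ordLess_imp_ordLeq ordLeq_transitive by blast
  qed
  define hom where "hom l A c \<longleftrightarrow>
      (\<forall>xs. set xs \<subseteq> A \<longrightarrow> length xs = len l \<longrightarrow> increasing R xs \<longrightarrow> C l xs = c)" for l A c
  \<comment> \<open>Sets at least as large as every \<open>B i\<close> are demanded, not just one
    infinite set, because each further colouring uses up finitely many stages of the
    hierarchy.\<close>
  define good where "good s \<longleftrightarrow>
      (\<forall>i\<in>Field omega1. \<exists>A\<subseteq>M. |B i| \<le>o |A| \<and> (\<forall>l<length s. hom l A (s ! l)))" for s
  have "good []"
  proof -
    have "\<exists>A\<subseteq>M. |B i| \<le>o |A|" if "i \<in> Field omega1" for i
      using B_le that by blast
    then show ?thesis
      by (simp add: good_def)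
  qed
  have extend: "\<exists>c. good (s @ [c])" if "good s" for s
  proof (rule ccontr)
    assume "\<nexists>c. good (s @ [c])"
    then obtain k where k: "\<And>c. k c \<in> Field omega1"
      and bad: "\<And>c A. A \<subseteq> M \<Longrightarrow> |B (k c)| \<le>o |A| \<Longrightarrow> \<exists>l<length (s @ [c]). \<not> hom l A ((s @ [c]) ! l)"
      unfolding good_def by metis
    \<comment> \<open>Pigeonhole over the countable ordinals: every colour \<open>c\<close> fails at
      some \<open>k c\<close>, and the countably many \<open>k c\<close> have a common bound. A
      homogeneous set as large as \<open>B j\<close> then contradicts the failure of its own
      colour.\<close>
    obtain j where j: "j \<in> Field omega1" "\<And>c. (k c, j) \<in> omega1"
      using countable_bounded_omega1[of "range k"] k by auto
    \<comment> \<open>Each application of \<open>nxt\<close> gains a powerset; \<open>2 * n\<close>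
      of them above \<open>j\<close> are what the Erdos-Rado theorem needs to return a set as large
      as \<open>B j\<close>.\<close>
    obtain nxt where nxt: "\<And>i. i \<in> Field omega1 \<Longrightarrow> nxt i \<in> Field omega1 \<and> (i, nxt i) \<in> omega1 - Id"
      using omega1_unbounded by metis
    have it: "(nxt ^^ n) j \<in> Field omega1" for n
      by (induction n) (use j nxt in auto)
    define n where "n = len (length s)"
    define D where "D n = B ((nxt ^^ n) j)" for n
    have D0: "D 0 = B j"
      by (simp add: D_def)
    have "|Pow (D n)| \<le>o |D (Suc n)|" for n
      using nxt[OF it[of n]] by (auto simp: D_def intro!: Pow_le)
    moreover obtain A where A: "A \<subseteq> M" "|D (2 * n)| \<le>o |A|"
      and homA: "\<And>l. l < length s \<Longrightarrow> hom l A (s ! l)"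
      using \<open>good s\<close> it[of "2 * n"] unfolding good_def D_def by meson
    ultimately obtain A' c where A': "A' \<subseteq> A" "|D 0| \<le>o |A'|" and homc: "hom (length s) A' c"
      using erdos_rado_nat_colouring[OF R, of D n A "C (length s)"] infB[OF j(1)]
      unfolding hom_def n_def D0 by blast
    have "|B (k c)| \<le>o |A'|"
      using A'(2) B_mono[OF j(2)] unfolding D0 by (rule ordLeq_transitive[rotated])
    moreover have "hom l A' ((s @ [c]) ! l)" if "l < length (s @ [c])" for l
    proof (cases "l < length s")
      case True
      then show ?thesis
        using homA[OF True] A'(1) by (auto simp: hom_def nth_append)
    next
      case False
      then have "l = length s"
        using that by simp
      then show ?thesis
        using homc by simp
    qed
    ultimately show False
      using bad A A' by blast
  qed
  obtain s where s: "\<And>n. good (s n) \<and> length (s n) = n" and s_Suc: "\<And>n. \<exists>c. s (Suc n) = s n @ [c]"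
    using dependent_nat_choice[of "\<lambda>n s. good s \<and> length s = n" "\<lambda>n s s'. \<exists>c. s' = s @ [c]"]
      \<open>good []\<close> extend by (auto; metis length_append_singleton)
  \<comment> \<open>The lists \<open>s n\<close> extend one another, so their entries at
    \<open>l\<close> agree as soon as they exist.\<close>
  define v where "v l = s (Suc l) ! l" for l
  have nth_s: "s n ! l = v l" if "l < n" for l n
    using that
  proof (induction n)
    case (Suc n)
    show ?case
    proof (cases "l = n")
      case False
      then have "s (Suc n) ! l = s n ! l"
        using Suc.prems s_Suc[of n] s[of n] by (auto simp: nth_append)
      then show ?thesis
        using Suc False by simp
    qed (simp add: v_def)
  qed simp
  \<comment> \<open>Any index will do: from here on it matters only that \<open>B i\<close> is
    infinite.\<close>
  obtain i where i: "i \<in> Field omega1"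
    using uncountable_Field_omega1 by fastforce
  show thesis
  proof (rule that)
    fix K
    obtain A where "A \<subseteq> M" "|B i| \<le>o |A|" "\<And>l. l < K \<Longrightarrow> hom l A (v l)"
      using s[of K] i nth_s[of _ K] unfolding good_def by metis
    then show "\<exists>A\<subseteq>M. infinite A \<and> (\<forall>l<K. \<forall>xs. set xs \<subseteq> A \<longrightarrow> length xs = len l \<longrightarrow>
        increasing R xs \<longrightarrow> C l xs = v l)"
      using infB[OF i] card_of_ordLeq_infinite unfolding hom_def by blast
  qed
qed

section \<open>Indiscernible sequences as filters of assignments\<close>

lemma ex_strict_wellorder: "\<exists>R :: 'a rel. wf R \<and> total R \<and> trans R"
proof -
  obtain r :: "'a rel" where r: "well_order_on UNIV r"
    using well_order_on by blast
  then have "Linear_order r" "wf (r - Id)" "Field r = UNIV"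
    using well_order_on_Field[OF r] by (auto simp: well_order_on_def)
  then have "wf (r - Id) \<and> total (r - Id) \<and> trans (r - Id)"
    unfolding order_on_defs by (simp add: trans_diff_Id)
  then show ?thesis
    by blast
qed

lemma ex_increasing_list:
  assumes R: "wf R" "total R" and "finite X"
  shows "\<exists>xs. set xs = X \<and> increasing R xs"
  using assms(3)
proof (induction X rule: finite_psubset_induct)
  case (psubset X)
  show ?case
  proof (cases "X = {}")
    case False
    then obtain m where m: "m \<in> X" "\<forall>y. (y, m) \<in> R \<longrightarrow> y \<notin> X"
      using R(1) unfolding wf_eq_minimal by (metis ex_in_conv)
    then obtain xs where xs: "set xs = X - {m}" "increasing R xs"
      using psubset.IH[of "X - {m}"] by blast
    have "(m, y) \<in> R" if "y \<in> X - {m}" for y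
      using that m R(2) unfolding total_on_def by blast
    then show ?thesis
      using xs m by (intro exI[of _ "m # xs"]) auto
  qed simp
qed

text \<open>
  The filter consists of the assignments whose values on ever larger finite sets of indices form
  increasing sequences that are homogeneous for ever more colourings.
\<close>

lemma indiscernible_filter:
  fixes \<C> :: "('a list \<Rightarrow> nat) set" and M :: "'a set"
  assumes "countable \<C>" and M: "has_card_beth omega1 M"
  shows "\<exists>F :: ('i \<Rightarrow> 'a) filter. F \<noteq> bot \<and> (\<forall>\<^sub>F \<rho> in F. range \<rho> \<subseteq> M) \<and>
    (\<forall>i j. i \<noteq> j \<longrightarrow> (\<forall>\<^sub>F \<rho> in F. \<rho> i \<noteq> \<rho> j)) \<and>
    (\<forall>c\<in>\<C>. \<forall>is. \<exists>v. \<forall>\<^sub>F \<rho> in F. c (map \<rho> is) = v)"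
proof -
  obtain R :: "'a rel" where R: "wf R" "total R"
    using ex_strict_wellorder by blast
  obtain Q :: "'i rel" where Q: "wf Q" "total Q" "trans Q"
    using ex_strict_wellorder by blast
  \<comment> \<open>Each \<open>c\<close> is combined with all patterns \<open>idx\<close>, which
    feed it the entries of an increasing sequence in any order and with repetitions, and with all
    lengths of that sequence.\<close>
  define e where "e = from_nat_into (\<C> \<times> (UNIV :: nat list set) \<times> (UNIV :: nat set))"
  define C where "C l xs = (case e l of (c, idx, n) \<Rightarrow> c (map ((!) xs) idx))" for l xs
  define len where "len l = snd (snd (e l))" for l
  have index: "\<exists>l. len l = n \<and> (\<forall>xs. C l xs = c (map ((!) xs) idx))" if "c \<in> \<C>" for c idx n
  proof -
    have "countable (\<C> \<times> (UNIV :: nat list set) \<times> (UNIV :: nat set))"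
      using assms(1) by (intro countable_SIGMA) auto
    moreover have "(c, idx, n) \<in> \<C> \<times> UNIV \<times> UNIV"
      using that by simp
    ultimately have "\<exists>l. e l = (c, idx, n)"
      unfolding e_def by (rule from_nat_into_surj)
    then obtain l where "e l = (c, idx, n)" ..
    then show ?thesis
      by (intro exI[of _ l]) (simp add: C_def len_def)
  qed
  obtain v where v: "\<And>K. \<exists>A\<subseteq>M. infinite A \<and> (\<forall>l<K. \<forall>xs. set xs \<subseteq> A \<longrightarrow> length xs = len l \<longrightarrow>
      increasing R xs \<longrightarrow> C l xs = v l)"
    by (rule homogeneous_template[OF R M, of len C]) (rule that)
  define G where "G W K = {\<rho>. range \<rho> \<subseteq> M \<and> (\<forall>i\<in>W. \<forall>j\<in>W. (i, j) \<in> Q \<longrightarrow> (\<rho> i, \<rho> j) \<in> R) \<and>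
      (\<forall>l<K. \<forall>xs. set xs \<subseteq> \<rho> ` W \<longrightarrow> length xs = len l \<longrightarrow> increasing R xs \<longrightarrow> C l xs = v l)}"
    for W :: "'i set" and K :: nat
  have G_mono: "G W' K' \<subseteq> G W K" if "W \<subseteq> W'" "K \<le> K'" for W W' K K'
  proof
    fix \<rho> assume \<rho>: "\<rho> \<in> G W' K'"
    have "C l xs = v l"
      if "l < K" "set xs \<subseteq> \<rho> ` W" "length xs = len l" "increasing R xs" for l xs
    proof -
      have "l < K'" "set xs \<subseteq> \<rho> ` W'"
        using that \<open>W \<subseteq> W'\<close> \<open>K \<le> K'\<close> by auto
      then show ?thesis
        using \<rho> that by (simp add: G_def)
    qed
    then show "\<rho> \<in> G W K"
      using \<rho> \<open>W \<subseteq> W'\<close> by (simp add: G_def subset_iff)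
  qed
  have G_nonempty: "G W K \<noteq> {}" if "finite W" for W K
  proof -
    obtain A where A: "A \<subseteq> M" "infinite A" and hom: "\<And>l xs. l < K \<Longrightarrow> set xs \<subseteq> A \<Longrightarrow>
        length xs = len l \<Longrightarrow> increasing R xs \<Longrightarrow> C l xs = v l"
      using v[of K] by blast
    \<comment> \<open>One element more than \<open>card W\<close>: for \<open>w\<close> outside
      \<open>W\<close> the position \<open>pos w\<close> can equal \<open>card W\<close>, and
      \<open>\<rho>\<close> must map every index into \<open>A\<close>.\<close>
    obtain X where X: "X \<subseteq> A" "finite X" "card X = Suc (card W)"
      using infinite_arbitrarily_large[OF A(2)] by blast
    obtain xs where xs: "set xs = X" "increasing R xs"
      using ex_increasing_list[OF R(1,2) X(2)] by blast
    have len_xs: "card W < length xs"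
      using card_length[of xs] xs X by simp
    define pos where "pos w = card {u \<in> W. (u, w) \<in> Q}" for w
    have pos_less: "pos w < length xs" for w
      unfolding pos_def using len_xs card_mono[OF that, of "{u \<in> W. (u, w) \<in> Q}"] by fastforce
    define \<rho> where "\<rho> w = xs ! pos w" for w
    have range: "range \<rho> \<subseteq> A"
      using pos_less xs X by (auto simp: \<rho>_def)
    moreover have "(\<rho> i, \<rho> j) \<in> R" if "i \<in> W" "(i, j) \<in> Q" for i j
    proof -
      have "(i, i) \<notin> Q"
        using Q(1) by (rule wf_not_refl)
      then have "{u \<in> W. (u, i) \<in> Q} \<subset> {u \<in> W. (u, j) \<in> Q}"
        using that Q(3) unfolding trans_def by blast
      then have "pos i < pos j"
        unfolding pos_def using \<open>finite W\<close> by (intro psubset_card_mono) auto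
      then show ?thesis
        unfolding \<rho>_def using sorted_wrt_nth_less[OF xs(2) _ pos_less] by simp
    qed
    moreover have "C l ys = v l"
      if "l < K" "set ys \<subseteq> \<rho> ` W" "length ys = len l" "increasing R ys" for l ys
      using that range by (intro hom) auto
    ultimately have "\<rho> \<in> G W K"
      using A(1) by (auto simp: G_def)
    then show ?thesis
      by blast
  qed
  \<comment> \<open>The sets \<open>G W K\<close> decrease in both arguments, so those with finite
    \<open>W\<close> form a base of \<open>F\<close>.\<close>
  define F where "F = (INF p\<in>{W. finite W} \<times> UNIV. principal (G (fst p) (snd p)))"
  have ev: "eventually P F \<longleftrightarrow> (\<exists>W K. finite W \<and> (\<forall>\<rho>\<in>G W K. P \<rho>))" for P
  proof -
    have "eventually P F \<longleftrightarrow>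
        (\<exists>p\<in>{W. finite W} \<times> UNIV. eventually P (principal (G (fst p) (snd p))))"
      unfolding F_def
    proof (rule eventually_INF_base)
      fix p q :: "'i set \<times> nat"
      assume "p \<in> {W. finite W} \<times> UNIV" "q \<in> {W. finite W} \<times> UNIV"
      then show "\<exists>x\<in>{W. finite W} \<times> UNIV. principal (G (fst x) (snd x))
          \<le> inf (principal (G (fst p) (snd p))) (principal (G (fst q) (snd q)))"
        using G_mono by (intro bexI[of _ "(fst p \<union> fst q, max (snd p) (snd q))"]) auto
    qed auto
    then show ?thesis
      by (auto simp: eventually_principal)
  qed
  show ?thesis
  proof (intro exI[of _ F] conjI allI impI ballI)
    show "F \<noteq> bot"
      unfolding trivial_limit_def ev using G_nonempty by blast
    show "\<forall>\<^sub>F \<rho> in F. range \<rho> \<subseteq> M"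
      unfolding ev by (intro exI[of _ "{}"]) (auto simp: G_def)
    show "\<forall>\<^sub>F \<rho> in F. \<rho> i \<noteq> \<rho> j" if "i \<noteq> j" for i j
    proof -
      have "(x, x) \<notin> R" for x
        using R(1) by (rule wf_not_refl)
      moreover have "(i, j) \<in> Q \<or> (j, i) \<in> Q"
        using that Q(2) by (simp add: total_on_def)
      ultimately show ?thesis
        unfolding ev by (intro exI[of _ "{i, j}"] exI[of _ 0]) (auto simp: G_def; metis)
    qed
    show "\<exists>x. \<forall>\<^sub>F \<rho> in F. c (map \<rho> is) = x" if c: "c \<in> \<C>" for c "is"
    proof -
      obtain ws where ws: "set ws = set is" "increasing Q ws"
        using ex_increasing_list[OF Q(1,2)] by blast
      have "\<forall>i\<in>set is. \<exists>n. n < length ws \<and> ws ! n = i"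
        unfolding ws(1)[symmetric] by (auto simp: in_set_conv_nth)
      then obtain p where p: "\<forall>i\<in>set is. p i < length ws \<and> ws ! p i = i"
        by (rule bchoice[elim_format]) blast
      \<comment> \<open>\<open>ws\<close> sorts the indices of \<open>is\<close> and
        \<open>p\<close> finds their places in it, so \<open>c (map \<rho> is)\<close> is colouring
        \<open>l\<close> at the increasing sequence \<open>map \<rho> ws\<close>. The bound
        \<open>Suc l\<close> below puts \<open>l\<close> among the controlled colourings.\<close>
      obtain l where l: "len l = length ws" "\<And>xs. C l xs = c (map ((!) xs) (map p is))"
        using index[OF c] by blast
      have "c (map \<rho> is) = v l" if \<rho>: "\<rho> \<in> G (set is) (Suc l)" for \<rho>
      proof -
        have "increasing R (map \<rho> ws)"
          using ws \<rho> by (auto simp: sorted_wrt_map G_def intro: sorted_wrt_mono_rel[rotated])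
        then have "C l (map \<rho> ws) = v l"
          using \<rho> ws(1) l(1) by (auto simp: G_def)
        moreover have "map ((!) (map \<rho> ws)) (map p is) = map \<rho> is"
          using p by simp
        ultimately show ?thesis
          by (simp only: l(2))
      qed
      then show ?thesis
        unfolding ev by blast
    qed
  qed
qed

section \<open>The hull of an indiscernible sequence\<close>

lemma finite_tvars: "finite (tvars t)"
  by (induction t) auto

lemma finite_fvars: "finite (fvars \<phi>)"
  by (induction \<phi>) (auto simp: finite_tvars)

lemma tval_cong:
  assumes "\<And>n. n \<in> tvars t \<Longrightarrow> e n = e' n"
  shows "tval M e t = tval M e' t"
  using assms
proof (induction t)
  case (Fun f ts)
  then have "map (tval M e) ts = map (tval M e') ts"
    by (intro map_cong) auto
  then show ?case
    by (simp only: tval.simps)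
qed simp

lemma sat_cong:
  assumes "\<And>n. n \<in> fvars \<phi> \<Longrightarrow> e n = e' n"
  shows "sat M e \<phi> \<longleftrightarrow> sat M e' \<phi>"
  using assms
proof (induction \<phi> arbitrary: e e')
  case (Eq s t)
  then show ?case
    using tval_cong[of s e e' M] tval_cong[of t e e' M] by simp
next
  case (Rel R ts)
  then have "map (tval M e) ts = map (tval M e') ts"
    by (intro map_cong tval_cong) auto
  then show ?case
    by (simp only: sat.simps)
next
  case (Imp \<phi> \<psi>)
  have "sat M e \<phi> \<longleftrightarrow> sat M e' \<phi>" "sat M e \<psi> \<longleftrightarrow> sat M e' \<psi>"
    using Imp.prems by (auto intro!: Imp.IH)
  then show ?case
    by simp
next
  case (Forall x \<phi>)
  have "sat M (e(x := a)) \<phi> \<longleftrightarrow> sat M (e'(x := a)) \<phi>" for a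
    using Forall.prems by (intro Forall.IH) auto
  then show ?case
    by simp
qed simp

instance fterm :: (countable) countable
  by countable_datatype

instance form :: (countable, countable) countable
  by countable_datatype

lemma wf_term_symbols: "wf_term L t \<Longrightarrow> set_fterm t \<subseteq> funs L"
  by (induction t) auto

lemma wf_form_symbols: "wf_form L \<phi> \<Longrightarrow> set1_form \<phi> \<subseteq> funs L \<and> set2_form \<phi> \<subseteq> rels L"
  by (induction \<phi>) (use wf_term_symbols in fastforce)+

text \<open>The types of symbols may be uncountable; renaming the countably many symbols of
  \<open>L\<close> to natural numbers is injective on well-formed formulas and lands in a countable
  type.\<close>

lemma countable_wf_forms:
  assumes "countable_language L"
  shows "countable {\<phi>. wf_form L \<phi>}"
proof (rule countableI')
  show "inj_on (map_form (to_nat_on (funs L)) (to_nat_on (rels L))) {\<phi>. wf_form L \<phi>}"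
  proof (rule inj_onI)
    fix \<phi> \<psi>
    assume wf: "\<phi> \<in> {\<phi>. wf_form L \<phi>}" "\<psi> \<in> {\<phi>. wf_form L \<phi>}"
      and eq: "map_form (to_nat_on (funs L)) (to_nat_on (rels L)) \<phi>
        = map_form (to_nat_on (funs L)) (to_nat_on (rels L)) \<psi>"
    have "set1_form \<phi> \<subseteq> funs L" "set1_form \<psi> \<subseteq> funs L"
      "set2_form \<phi> \<subseteq> rels L" "set2_form \<psi> \<subseteq> rels L"
      using wf wf_form_symbols by auto
    then show "\<phi> = \<psi>"
      using assms form.inj_map_strong[OF _ _ eq] to_nat_on_inj
      unfolding countable_language_def by (metis subsetD)
  qed
qed

text \<open>
  Terms in the generators \<open>Gen i\<close>; the function symbols are indices into a sequence of operations.
\<close>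

datatype 'v hterm = Gen 'v | App nat "'v hterm list"

instance hterm :: (countable) countable
  by countable_datatype

primrec hval :: "(nat \<Rightarrow> 'a list \<Rightarrow> 'a) \<Rightarrow> ('v \<Rightarrow> 'a) \<Rightarrow> 'v hterm \<Rightarrow> 'a" where
  "hval h \<rho> (Gen i) = \<rho> i"
| "hval h \<rho> (App k ts) = h k (map (hval h \<rho>) ts)"

lemma hval_map_hterm: "hval h \<rho> (map_hterm g t) = hval h (\<lambda>i. \<rho> (g i)) t"
proof (induction t)
  case (App k ts)
  then show ?case
    by (auto simp: comp_def intro!: arg_cong[of _ _ "h k"])
qed simp

lemma hval_cong:
  assumes "\<And>i. i \<in> set_hterm t \<Longrightarrow> \<rho> i = \<sigma> i"
  shows "hval h \<rho> t = hval h \<sigma> t"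
  using assms
proof (induction t)
  case (App k ts)
  then have "map (hval h \<rho>) ts = map (hval h \<sigma>) ts"
    by (intro map_cong) auto
  then show ?case
    by (simp only: hval.simps)
qed simp

lemma finite_set_hterm: "finite (set_hterm t)"
  by (induction t) auto

text \<open>A term amounts to a term in natural numbers and a list of the generators they stand for,
  and there are no more such pairs than elements of \<open>'i\<close>. Hence classes of terms can be
  coded in \<open>'i\<close>.\<close>

lemma ex_inj_hterm:
  assumes "infinite (UNIV :: 'i set)"
  shows "\<exists>g :: 'i hterm \<Rightarrow> 'i. inj g"
proof -
  define T where "T = (UNIV :: nat hterm set)"
  have "t \<in> (\<lambda>(t, is). map_hterm ((!) is) t) ` (T \<times> lists UNIV)" for t :: "'i hterm"
  proof -
    obtain "is" where "is": "set is = set_hterm t"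
      using finite_list[OF finite_set_hterm[of t]] by blast
    then have "\<forall>i\<in>set_hterm t. \<exists>n. is ! n = i"
      unfolding "is"[symmetric] by (auto simp: in_set_conv_nth)
    then obtain p where p: "\<forall>i\<in>set_hterm t. is ! p i = i"
      using bchoice by metis
    have "map_hterm ((!) is) (map_hterm p t) = map_hterm id t"
      unfolding hterm.map_comp using p by (intro hterm.map_cong) auto
    then have "t = map_hterm ((!) is) (map_hterm p t)"
      by (simp add: hterm.map_id)
    then show ?thesis
      by (intro image_eqI[of _ _ "(map_hterm p t, is)"]) (auto simp: T_def)
  qed
  then have "|UNIV :: 'i hterm set| \<le>o |T \<times> lists (UNIV :: 'i set)|"
    by (intro surj_imp_ordLeq) blast
  also have "|T \<times> lists (UNIV :: 'i set)| \<le>o |UNIV :: 'i set|"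
  proof -
    have "|T| \<le>o natLeq"
      by (simp add: flip: countable_card_le_natLeq)
    also have "natLeq \<le>o |UNIV :: 'i set|"
      using assms infinite_iff_natLeq_ordLeq[of "UNIV :: 'i set"] by blast
    finally show ?thesis
      using assms card_of_lists_le[OF assms] by (intro card_of_Sigma_ordLeq_infinite) simp_all
  qed
  finally show ?thesis
    by (auto simp flip: card_of_ordLeq)
qed

text \<open>Values of terms are functions of the generators. Composing the colourings with all lists
  of terms in natural numbers keeps the family countable, and an arbitrary \<open>ts\<close> becomes
  such a list once its finitely many generators are numbered.\<close>

lemma indiscernible_hterm_filter:
  fixes \<C> :: "('a list \<Rightarrow> nat) set" and M :: "'a set"
  assumes "countable \<C>" and "has_card_beth omega1 M"
  shows "\<exists>F :: ('i \<Rightarrow> 'a) filter. F \<noteq> bot \<and> (\<forall>\<^sub>F \<rho> in F. range \<rho> \<subseteq> M) \<and>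
    (\<forall>i j. i \<noteq> j \<longrightarrow> (\<forall>\<^sub>F \<rho> in F. \<rho> i \<noteq> \<rho> j)) \<and>
    (\<forall>c\<in>\<C>. \<forall>ts. \<exists>v. \<forall>\<^sub>F \<rho> in F. c (map (hval h \<rho>) ts) = v)"
proof -
  define \<D> where "\<D> = (\<lambda>(c, ts) as. c (map (hval h ((!) as)) ts)) ` (\<C> \<times> UNIV)"
  have "countable \<D>"
    unfolding \<D>_def using assms(1) by (intro countable_image countable_SIGMA) auto
  then obtain F :: "('i \<Rightarrow> 'a) filter" where F: "F \<noteq> bot" "\<forall>\<^sub>F \<rho> in F. range \<rho> \<subseteq> M"
    "\<forall>i j. i \<noteq> j \<longrightarrow> (\<forall>\<^sub>F \<rho> in F. \<rho> i \<noteq> \<rho> j)"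
    and const: "\<forall>c\<in>\<D>. \<forall>is. \<exists>v. \<forall>\<^sub>F \<rho> in F. c (map \<rho> is) = v"
    using indiscernible_filter[OF _ assms(2), of \<D>, where ?'i = 'i]
    by (elim meta_impE exE conjE) (assumption | rule that)+
  have "\<exists>v. \<forall>\<^sub>F \<rho> in F. c (map (hval h \<rho>) ts) = v" if c: "c \<in> \<C>" for c ts
  proof -
    obtain "is" where "is": "set is = (\<Union>t\<in>set ts. set_hterm t)"
      using finite_list[of "\<Union>t\<in>set ts. set_hterm t"] finite_set_hterm by auto
    have "\<forall>i\<in>set is. \<exists>n. n < length is \<and> is ! n = i"
      by (auto simp: in_set_conv_nth)
    then obtain p where p: "\<forall>i\<in>set is. p i < length is \<and> is ! p i = i"
      by (rule bchoice[elim_format]) blast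
    define ts' where "ts' = map (map_hterm p) ts"
    have "map (hval h ((!) (map \<rho> is))) ts' = map (hval h \<rho>) ts" for \<rho> :: "'i \<Rightarrow> 'a"
      unfolding ts'_def using p "is"
      by (auto simp: hval_map_hterm intro!: hval_cong)
    moreover have "(\<lambda>as. c (map (hval h ((!) as)) ts')) \<in> \<D>"
      unfolding \<D>_def using c by (intro image_eqI[of _ _ "(c, ts')"]) auto
    ultimately show ?thesis
      using const[rule_format, of "\<lambda>as. c (map (hval h ((!) as)) ts')" "is"] by simp
  qed
  then show ?thesis
    using F by blast
qed

section \<open>Skolem functions and enumerations of solution sets\<close>

text \<open>Parameters come as a list, so that Skolem functions and enumerations are operations on
  lists, as the symbols of \<open>hterm\<close> require.\<close>

definition env :: "'a \<Rightarrow> 'a list \<Rightarrow> nat \<Rightarrow> 'a" where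
  "env d as n = (if n < length as then as ! n else d)"

text \<open>A counterexample is chosen, not a witness, because \<open>Forall\<close> is the
  primitive quantifier.\<close>

definition skolem ::
  "('f, 'r, 'a) struct \<Rightarrow> 'a \<Rightarrow> ('f, 'r) form \<Rightarrow> nat \<Rightarrow> 'a list \<Rightarrow> 'a" where
  "skolem M d \<phi> x as = (if \<exists>a\<in>univ M. \<not> sat M ((env d as)(x := a)) \<phi>
     then SOME a. a \<in> univ M \<and> \<not> sat M ((env d as)(x := a)) \<phi> else d)"

definition solutions :: "('f, 'r, 'a) struct \<Rightarrow> ('f, 'r) form \<Rightarrow> nat \<Rightarrow> (nat \<Rightarrow> 'a) \<Rightarrow> 'a set" where
  "solutions M \<phi> x e = {a \<in> univ M. sat M (e(x := a)) \<phi>}"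

text \<open>Meant for countable solution sets, all of whose elements it reaches; \<open>d\<close>
  keeps the value in the universe when there are no solutions.\<close>

definition enum ::
  "('f, 'r, 'a) struct \<Rightarrow> 'a \<Rightarrow> ('f, 'r) form \<Rightarrow> nat \<Rightarrow> nat \<Rightarrow> 'a list \<Rightarrow> 'a" where
  "enum M d \<phi> x k as = (if solutions M \<phi> x (env d as) = {} then d
     else from_nat_into (solutions M \<phi> x (env d as)) k)"

text \<open>On improper arguments \<open>fint\<close> may leave the universe; the default
  \<open>d\<close> yields an operation with values in the universe on all lists.\<close>

definition guarded_fint ::
  "('f, 'r) language \<Rightarrow> ('f, 'r, 'a) struct \<Rightarrow> 'a \<Rightarrow> 'f \<Rightarrow> 'a list \<Rightarrow> 'a" where
  "guarded_fint L M d f as =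
     (if set as \<subseteq> univ M \<and> length as = farity L f then fint M f as else d)"

lemma skolem_in: "d \<in> univ M \<Longrightarrow> skolem M d \<phi> x as \<in> univ M"
  unfolding skolem_def by (auto intro: someI2)

lemma skolem_counterexample:
  assumes "a \<in> univ M" "\<not> sat M ((env d as)(x := a)) \<phi>"
  shows "\<not> sat M ((env d as)(x := skolem M d \<phi> x as)) \<phi>"
  using someI[of "\<lambda>a. a \<in> univ M \<and> \<not> sat M ((env d as)(x := a)) \<phi>" a] assms
  unfolding skolem_def by auto

lemma enum_in: "d \<in> univ M \<Longrightarrow> enum M d \<phi> x k as \<in> univ M"
  using from_nat_into[of "solutions M \<phi> x (env d as)" k]
  unfolding enum_def by (auto simp: solutions_def)

lemma enum_surj:
  assumes "a \<in> solutions M \<phi> x (env d as)" "countable (solutions M \<phi> x (env d as))"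
  shows "\<exists>k. a = enum M d \<phi> x k as"
  using from_nat_into_surj[OF assms(2,1)] assms(1) unfolding enum_def by auto

lemma guarded_fint_in:
  "is_structure L M \<Longrightarrow> d \<in> univ M \<Longrightarrow> f \<in> funs L \<Longrightarrow> guarded_fint L M d f as \<in> univ M"
  unfolding guarded_fint_def is_structure_def by auto

text \<open>
  The limit of the Skolem hulls of \<open>range \<rho>\<close> along \<open>F\<close>: elements are named by terms, two terms
  name the same element iff their values eventually agree, and \<open>sat_limit_struct\<close> is the
  corresponding version of Los's theorem, where deciding formulas replaces an ultrafilter.
\<close>

locale limit_hull =
  fixes L :: "('f, 'r) language" and M :: "('f, 'r, 'a) struct" and d :: 'a
    and h :: "nat \<Rightarrow> 'a list \<Rightarrow> 'a" and F :: "('i \<Rightarrow> 'a) filter" and cls :: "'i hterm \<Rightarrow> 'b"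
  assumes h_in: "h k as \<in> univ M"
    and h_fint: "f \<in> funs L \<Longrightarrow> \<exists>k. h k = guarded_fint L M d f"
    and h_skolem: "wf_form L \<phi> \<Longrightarrow> \<exists>k. h k = skolem M d \<phi> x"
    and h_enum: "wf_form L \<phi> \<Longrightarrow> \<exists>l. h l = enum M d \<phi> x k"
    and nontrivial: "F \<noteq> bot"
    and range_in: "\<forall>\<^sub>F \<rho> in F. range \<rho> \<subseteq> univ M"
    and generators_distinct: "i \<noteq> j \<Longrightarrow> \<forall>\<^sub>F \<rho> in F. \<rho> i \<noteq> \<rho> j"
    and sat_const: "wf_form L \<phi> \<Longrightarrow>
      \<exists>v. \<forall>\<^sub>F \<rho> in F. sat M (env d (map (hval h \<rho>) ts)) \<phi> = v"
    and countable_const: "wf_form L \<phi> \<Longrightarrow>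
      \<exists>v. \<forall>\<^sub>F \<rho> in F. countable (solutions M \<phi> x (env d (map (hval h \<rho>) ts))) = v"
    and enum_const: "wf_form L \<phi> \<Longrightarrow>
      \<exists>v. \<forall>\<^sub>F \<rho> in F. (LEAST k. hval h \<rho> t = enum M d \<phi> x k (map (hval h \<rho>) ts)) = v"
    and cls_eq_iff: "cls s = cls t \<longleftrightarrow> (\<forall>\<^sub>F \<rho> in F. hval h \<rho> s = hval h \<rho> t)"
begin

definition fun_index :: "'f \<Rightarrow> nat" where
  "fun_index f = (SOME k. h k = guarded_fint L M d f)"

text \<open>\<open>inv cls\<close> picks a term that names an element; any other name would do,
  since terms of one class eventually agree along \<open>F\<close>.\<close>

definition limit_struct :: "('f, 'r, 'b) struct" where
  "limit_struct = \<lparr>univ = range cls,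
     fint = (\<lambda>f as. cls (App (fun_index f) (map (inv cls) as))),
     rint = (\<lambda>R as. \<forall>\<^sub>F \<rho> in F. rint M R (map (\<lambda>a. hval h \<rho> (inv cls a)) as))\<rparr>"

abbreviation "N \<equiv> limit_struct"

text \<open>The assignment in \<open>M\<close> with which Los's theorem compares \<open>e\<close>:
  terms naming the values of \<open>e\<close> are evaluated at \<open>\<rho>\<close>.\<close>

definition lift :: "('i \<Rightarrow> 'a) \<Rightarrow> (nat \<Rightarrow> 'b) \<Rightarrow> nat \<Rightarrow> 'a" where
  "lift \<rho> e n = hval h \<rho> (inv cls (e n))"

lemma univ_N: "univ N = range cls"
  by (simp add: limit_struct_def)

lemma fint_N: "fint N f as = cls (App (fun_index f) (map (inv cls) as))"
  by (simp add: limit_struct_def)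

lemma rint_N: "rint N R as \<longleftrightarrow> (\<forall>\<^sub>F \<rho> in F. rint M R (map (\<lambda>a. hval h \<rho> (inv cls a)) as))"
  by (simp add: limit_struct_def)

lemma h_fun_index: "f \<in> funs L \<Longrightarrow> h (fun_index f) = guarded_fint L M d f"
  unfolding fun_index_def using h_fint by (rule someI_ex)

lemma is_structure_N: "is_structure L N"
  by (simp add: is_structure_def univ_N fint_N)

lemma cls_inv: "a \<in> univ N \<Longrightarrow> cls (inv cls a) = a"
  by (auto simp: univ_N f_inv_into_f)

lemma hval_inv_cls: "\<forall>\<^sub>F \<rho> in F. hval h \<rho> (inv cls (cls t)) = hval h \<rho> t"
  unfolding cls_eq_iff[symmetric] by (rule cls_inv) (simp add: univ_N)

lemma hval_in: "range \<rho> \<subseteq> univ M \<Longrightarrow> hval h \<rho> t \<in> univ M"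
  by (cases t) (auto simp: h_in)

lemma range_lift: "range \<rho> \<subseteq> univ M \<Longrightarrow> range (lift \<rho> e) \<subseteq> univ M"
  by (auto simp: lift_def hval_in)

lemma lift_upd: "lift \<rho> (e(x := a)) = (lift \<rho> e)(x := hval h \<rho> (inv cls a))"
  by (auto simp: lift_def)

text \<open>Names for all variables up to the largest free one, so that \<open>env\<close> agrees
  with \<open>lift\<close> on the free variables; \<open>insert 0\<close> covers sentences, where
  the maximum would be over the empty set.\<close>

definition params :: "(nat \<Rightarrow> 'b) \<Rightarrow> ('f, 'r) form \<Rightarrow> 'i hterm list" where
  "params e \<phi> = map (\<lambda>n. inv cls (e n)) [0..<Suc (Max (insert 0 (fvars \<phi>)))]"

lemma env_params:
  assumes "n \<in> fvars \<phi>"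
  shows "env d (map (hval h \<rho>) (params e \<phi>)) n = lift \<rho> e n"
proof -
  have "n < Suc (Max (insert 0 (fvars \<phi>)))"
    using assms finite_fvars[of \<phi>] by (simp add: less_Suc_eq_le)
  then show ?thesis
    by (simp add: env_def params_def lift_def del: upt_Suc)
qed

lemma sat_env_params:
  "sat M (env d (map (hval h \<rho>) (params e \<phi>))) \<phi> \<longleftrightarrow> sat M (lift \<rho> e) \<phi>"
  by (intro sat_cong env_params)

lemma sat_env_params_upd:
  "sat M ((env d (map (hval h \<rho>) (params e \<phi>)))(x := a)) \<phi> \<longleftrightarrow> sat M ((lift \<rho> e)(x := a)) \<phi>"
  by (intro sat_cong) (simp add: env_params)

lemma solutions_env_params:
  "solutions M \<phi> x (env d (map (hval h \<rho>) (params e \<phi>))) = solutions M \<phi> x (lift \<rho> e)"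
  by (simp add: solutions_def sat_env_params_upd)

section \<open>Los's theorem for the limit\<close>

text \<open>The eventual equalities for the finitely many arguments hold simultaneously, and
  eventually all values lie in \<open>univ M\<close>, so the guard in \<open>guarded_fint\<close> is
  passed.\<close>

lemma tval_limit_struct:
  assumes "wf_term L t" "range e \<subseteq> univ N"
  shows "tval N e t \<in> univ N \<and> (\<forall>\<^sub>F \<rho> in F. hval h \<rho> (inv cls (tval N e t)) = tval M (lift \<rho> e) t)"
  using assms(1)
proof (induction t)
  case (Var x)
  have "e x \<in> univ N"
    using assms(2) by blast
  then show ?case
    by (simp add: lift_def)
next
  case (Fun f ts)
  define u where "u = App (fun_index f) (map (\<lambda>t. inv cls (tval N e t)) ts)"
  have u: "tval N e (Fun f ts) = cls u"
    by (simp add: fint_N u_def comp_def)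
  have "\<forall>\<^sub>F \<rho> in F. \<forall>t\<in>set ts. hval h \<rho> (inv cls (tval N e t)) = tval M (lift \<rho> e) t"
    using Fun by (intro eventually_ball_finite) auto
  with range_in hval_inv_cls[of u]
  have "\<forall>\<^sub>F \<rho> in F. hval h \<rho> (inv cls (cls u)) = tval M (lift \<rho> e) (Fun f ts)"
  proof eventually_elim
    case (elim \<rho>)
    have "map (hval h \<rho>) (map (\<lambda>t. inv cls (tval N e t)) ts) = map (tval M (lift \<rho> e)) ts"
      using elim(3) by simp
    then have "hval h \<rho> u = guarded_fint L M d f (map (tval M (lift \<rho> e)) ts)"
      using h_fun_index Fun.prems by (simp only: u_def hval.simps wf_term.simps)
    moreover have "set (map (tval M (lift \<rho> e)) ts) \<subseteq> univ M"
      using elim(1,3) hval_in by (auto simp flip: elim(3)[rule_format])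
    ultimately show ?case
      using elim(2) Fun.prems by (simp add: guarded_fint_def)
  qed
  then show ?case
    unfolding u by (simp add: univ_N)
qed

lemma sat_decided:
  assumes "wf_form L \<phi>"
  shows "(\<forall>\<^sub>F \<rho> in F. sat M (lift \<rho> e) \<phi>) \<or> (\<forall>\<^sub>F \<rho> in F. \<not> sat M (lift \<rho> e) \<phi>)"
proof -
  obtain v where "\<forall>\<^sub>F \<rho> in F. sat M (lift \<rho> e) \<phi> = v"
    using sat_const[OF assms, of "params e \<phi>"] unfolding sat_env_params by blast
  then show ?thesis
    by (cases v) simp_all
qed

theorem sat_limit_struct:
  assumes "wf_form L \<phi>" "range e \<subseteq> univ N"
  shows "sat N e \<phi> \<longleftrightarrow> (\<forall>\<^sub>F \<rho> in F. sat M (lift \<rho> e) \<phi>)"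
  using assms
proof (induction \<phi> arbitrary: e)
  case Falsum
  then show ?case
    using nontrivial by simp
next
  case (Eq s t)
  have s: "tval N e s \<in> univ N" "\<forall>\<^sub>F \<rho> in F. hval h \<rho> (inv cls (tval N e s)) = tval M (lift \<rho> e) s"
    and t: "tval N e t \<in> univ N" "\<forall>\<^sub>F \<rho> in F. hval h \<rho> (inv cls (tval N e t)) = tval M (lift \<rho> e) t"
    using tval_limit_struct Eq by auto
  have "tval N e s = tval N e t \<longleftrightarrow>
      (\<forall>\<^sub>F \<rho> in F. hval h \<rho> (inv cls (tval N e s)) = hval h \<rho> (inv cls (tval N e t)))"
    using cls_inv[OF s(1)] cls_inv[OF t(1)] by (simp flip: cls_eq_iff)
  also have "\<dots> \<longleftrightarrow> (\<forall>\<^sub>F \<rho> in F. tval M (lift \<rho> e) s = tval M (lift \<rho> e) t)"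
    by (rule eventually_subst) (use s(2) t(2) in eventually_elim, simp)
  finally show ?case
    by simp
next
  case (Rel R ts)
  have ts: "\<forall>\<^sub>F \<rho> in F. \<forall>t\<in>set ts. hval h \<rho> (inv cls (tval N e t)) = tval M (lift \<rho> e) t"
    using Rel tval_limit_struct by (intro eventually_ball_finite) auto
  have "sat N e (Rel R ts) \<longleftrightarrow> (\<forall>\<^sub>F \<rho> in F. rint M R (map (\<lambda>t. hval h \<rho> (inv cls (tval N e t))) ts))"
    by (simp add: rint_N comp_def)
  also have "\<dots> \<longleftrightarrow> (\<forall>\<^sub>F \<rho> in F. rint M R (map (tval M (lift \<rho> e)) ts))"
  proof (rule eventually_subst, use ts in eventually_elim)
    case (elim \<rho>)
    then have "map (\<lambda>t. hval h \<rho> (inv cls (tval N e t))) ts = map (tval M (lift \<rho> e)) ts"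
      by simp
    then show ?case
      by (simp only:)
  qed
  finally show ?case
    by simp
next
  case (Imp \<phi> \<psi>)
  have "sat N e (Imp \<phi> \<psi>) \<longleftrightarrow>
      ((\<forall>\<^sub>F \<rho> in F. sat M (lift \<rho> e) \<phi>) \<longrightarrow> (\<forall>\<^sub>F \<rho> in F. sat M (lift \<rho> e) \<psi>))"
    using Imp by simp
  \<comment> \<open>A premise that is not eventually true is eventually false, since formulas are
    decided along \<open>F\<close>; then the implication eventually holds vacuously.\<close>
  also have "\<dots> \<longleftrightarrow> (\<forall>\<^sub>F \<rho> in F. sat M (lift \<rho> e) \<phi> \<longrightarrow> sat M (lift \<rho> e) \<psi>)"
    using sat_decided[of \<phi> e] Imp.prems(1)
    by (auto elim: eventually_mono eventually_mp)
  finally show ?case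
    by simp
next
  case (Forall x \<phi>)
  have step: "sat N (e(x := a)) \<phi> \<longleftrightarrow>
      (\<forall>\<^sub>F \<rho> in F. sat M ((lift \<rho> e)(x := hval h \<rho> (inv cls a))) \<phi>)" if "a \<in> univ N" for a
  proof -
    have "range (e(x := a)) \<subseteq> univ N"
      using that Forall.prems(2) by auto
    then show ?thesis
      using Forall.IH Forall.prems(1) by (simp add: lift_upd)
  qed
  show ?case
  proof
    assume all: "sat N e (Forall x \<phi>)"
    obtain k where k: "h k = skolem M d \<phi> x"
      using h_skolem Forall.prems(1) by auto
    \<comment> \<open>\<open>w\<close> names the Skolem counterexample: if \<open>\<phi>\<close>
      eventually holds there, then eventually it has no counterexample.\<close>
    define w where "w = App k (params e \<phi>)"
    have "sat N (e(x := cls w)) \<phi>"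
      using all by (simp add: univ_N)
    then have "\<forall>\<^sub>F \<rho> in F. sat M ((lift \<rho> e)(x := hval h \<rho> (inv cls (cls w)))) \<phi>"
      using step[of "cls w"] by (simp add: univ_N)
    with hval_inv_cls[of w] show "\<forall>\<^sub>F \<rho> in F. sat M (lift \<rho> e) (Forall x \<phi>)"
    proof eventually_elim
      case (elim \<rho>)
      let ?as = "map (hval h \<rho>) (params e \<phi>)"
      have "sat M ((env d ?as)(x := skolem M d \<phi> x ?as)) \<phi>"
        using elim by (simp add: sat_env_params_upd w_def k)
      then have "sat M ((env d ?as)(x := a)) \<phi>" if "a \<in> univ M" for a
        using skolem_counterexample that by metis
      then show ?case
        by (simp add: sat_env_params_upd)
    qed
  next
    assume ev: "\<forall>\<^sub>F \<rho> in F. sat M (lift \<rho> e) (Forall x \<phi>)"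
    have "sat N (e(x := a)) \<phi>" if a: "a \<in> univ N" for a
      unfolding step[OF a] using ev range_in
      by eventually_elim (simp add: hval_in)
    then show "sat N e (Forall x \<phi>)"
      by simp
  qed
qed

lemma is_model_limit_struct:
  assumes "is_theory L T" "is_model L T M"
  shows "is_model L T N"
proof -
  have "sat N e \<phi>" if "\<phi> \<in> T" "range e \<subseteq> univ N" for \<phi> e
  proof -
    have "wf_form L \<phi>"
      using assms(1) that(1) by (simp add: is_theory_def is_sentence_def)
    moreover have "\<forall>\<^sub>F \<rho> in F. sat M (lift \<rho> e) \<phi>"
      using range_in
    proof eventually_elim
      case (elim \<rho>)
      then show ?case
        using assms(2) that(1) range_lift by (auto simp: is_model_def holds_def)
    qed
    ultimately show ?thesis
      using sat_limit_struct that(2) by blast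
  qed
  then show ?thesis
    using is_structure_N by (simp add: is_model_def holds_def)
qed

section \<open>Quasiminimality of the limit\<close>

text \<open>The index of a solution in the enumeration is constant along \<open>F\<close>, so every
  solution is named by one of the countably many terms
  \<open>App (index k) (params e \<phi>)\<close>. This is how new elements are omitted.\<close>

lemma countable_solutions_limit_struct:
  assumes wf: "wf_form L \<phi>" and e: "range e \<subseteq> univ N"
    and cnt: "\<forall>\<^sub>F \<rho> in F. countable (solutions M \<phi> x (lift \<rho> e))"
  shows "countable (solutions N \<phi> x e)"
proof -
  obtain index where index: "\<And>k. h (index k) = enum M d \<phi> x k"
    using h_enum[OF wf] by metis
  have "a \<in> range (\<lambda>k. cls (App (index k) (params e \<phi>)))" if a: "a \<in> solutions N \<phi> x e" for a
  proof -
    have a_in: "a \<in> univ N" and sat: "sat N (e(x := a)) \<phi>"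
      using a by (auto simp: solutions_def)
    have "range (e(x := a)) \<subseteq> univ N"
      using e a_in by auto
    then have "\<forall>\<^sub>F \<rho> in F. sat M ((lift \<rho> e)(x := hval h \<rho> (inv cls a))) \<phi>"
      using sat sat_limit_struct[OF wf] by (simp add: lift_upd)
    moreover obtain k where "\<forall>\<^sub>F \<rho> in F.
        (LEAST k. hval h \<rho> (inv cls a) = enum M d \<phi> x k (map (hval h \<rho>) (params e \<phi>))) = k"
      using enum_const[OF wf] by blast
    ultimately have "\<forall>\<^sub>F \<rho> in F. hval h \<rho> (inv cls a) = hval h \<rho> (App (index k) (params e \<phi>))"
      using cnt range_in
    proof eventually_elim
      case (elim \<rho>)
      then have "hval h \<rho> (inv cls a) \<in> solutions M \<phi> x (env d (map (hval h \<rho>) (params e \<phi>)))"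
        by (simp add: solutions_def hval_in sat_env_params_upd)
      \<comment> \<open>Countability in \<open>M\<close> makes the enumeration reach the value, so
        the constant \<open>LEAST\<close> is a genuine index.\<close>
      then have "\<exists>k. hval h \<rho> (inv cls a) = enum M d \<phi> x k (map (hval h \<rho>) (params e \<phi>))"
        using elim by (intro enum_surj) (simp_all add: solutions_env_params)
      then have "hval h \<rho> (inv cls a) = enum M d \<phi> x k (map (hval h \<rho>) (params e \<phi>))"
        by (rule LeastI_ex[of "\<lambda>k. hval h \<rho> (inv cls a) =
              enum M d \<phi> x k (map (hval h \<rho>) (params e \<phi>))", unfolded elim(2)])
      then show ?case
        by (simp add: index)
    qed
    then have "cls (inv cls a) = cls (App (index k) (params e \<phi>))"
      by (simp only: cls_eq_iff)
    then show ?thesis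
      using cls_inv[OF a_in] by auto
  qed
  then have "solutions N \<phi> x e \<subseteq> range (\<lambda>k. cls (App (index k) (params e \<phi>)))"
    by blast
  then show ?thesis
    by (rule countable_subset) simp
qed

lemma inj_cls_Gen: "inj (\<lambda>i. cls (Gen i))"
proof (rule injI, rule ccontr)
  fix i j assume "cls (Gen i) = cls (Gen j)" "i \<noteq> j"
  then have "\<forall>\<^sub>F \<rho> in F. \<rho> i = \<rho> j" "\<forall>\<^sub>F \<rho> in F. \<rho> i \<noteq> \<rho> j"
    by (simp_all add: cls_eq_iff generators_distinct)
  then have "\<forall>\<^sub>F \<rho> in F. False"
    by eventually_elim simp
  then show False
    using nontrivial by simp
qed

lemma card_univ_limit_struct: "|UNIV :: 'i set| \<le>o |univ N|"
  using inj_cls_Gen card_of_ordLeq[of UNIV "univ N"] by (auto simp: univ_N)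

text \<open>Whether \<open>\<phi>\<close> has countably many solutions in \<open>M\<close> is
  decided along \<open>F\<close>; accordingly \<open>\<phi>\<close> or its negation has countably
  many solutions in the limit.\<close>

lemma quasiminimal_limit_struct:
  assumes "quasiminimal L M" "\<not> countable (UNIV :: 'i set)"
  shows "quasiminimal L N"
proof -
  have "\<not> countable (univ N)"
  proof
    assume "countable (univ N)"
    then have "countable (range (\<lambda>i. cls (Gen i)))"
      by (rule countable_subset[rotated]) (auto simp: univ_N)
    then show False
      using assms(2) inj_cls_Gen by (simp add: countable_image_inj_eq)
  qed
  moreover have "countable X \<or> countable (univ N - X)" if "definable_subset L N X" for X
  proof -
    obtain \<phi> x e where wf: "wf_form L \<phi>" and e: "range e \<subseteq> univ N" and X: "X = solutions N \<phi> x e"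
      using \<open>definable_subset L N X\<close> by (auto simp: definable_subset_def solutions_def)
    have Neg: "solutions K (Neg \<phi>) x e' = univ K - solutions K \<phi> x e'"
      for K :: "('f, 'r, 'c) struct" and e'
      by (auto simp: solutions_def)
    obtain v where v: "\<forall>\<^sub>F \<rho> in F. countable (solutions M \<phi> x (lift \<rho> e)) = v"
      using countable_const[OF wf, of x "params e \<phi>"] by (auto simp: solutions_env_params)
    show ?thesis
    proof (cases v)
      case True
      then have "\<forall>\<^sub>F \<rho> in F. countable (solutions M \<phi> x (lift \<rho> e))"
        using v by simp
      then show ?thesis
        unfolding X using countable_solutions_limit_struct wf e by blast
    next
      case False
      \<comment> \<open>An uncountable definable subset of the quasiminimal \<open>M\<close> has a
        countable complement, which the negation defines.\<close>
      have "\<forall>\<^sub>F \<rho> in F. countable (solutions M (Neg \<phi>) x (lift \<rho> e))"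
        using v range_in
      proof eventually_elim
        case (elim \<rho>)
        then have "definable_subset L M (solutions M \<phi> x (lift \<rho> e))"
          using wf range_lift unfolding definable_subset_def solutions_def by blast
        then show ?case
          using assms(1) elim False by (auto simp: quasiminimal_def Neg)
      qed
      then have "countable (solutions N (Neg \<phi>) x e)"
        using wf e by (intro countable_solutions_limit_struct) auto
      then show ?thesis
        by (simp add: X Neg)
    qed
  qed
  ultimately show ?thesis
    using is_structure_N by (simp add: quasiminimal_def)
qed

end

section \<open>Existence of the limit over a countable language\<close>

lemma ex_limit_hull:
  fixes L :: "('f, 'r) language" and M :: "('f, 'r, 'a) struct"
  assumes L: "countable_language L" and M: "is_structure L M" and "has_card_beth omega1 (univ M)"
    and "infinite (UNIV :: 'i set)"
  shows "\<exists>d h F (cls :: 'i hterm \<Rightarrow> 'i). limit_hull L M d h F cls"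
proof -
  obtain d where d: "d \<in> univ M"
    using M by (auto simp: is_structure_def)
  define \<F> where "\<F> = {\<phi>. wf_form L \<phi>}"
  have \<F>: "countable \<F>"
    unfolding \<F>_def using L by (rule countable_wf_forms)
  define H where "H = guarded_fint L M d ` funs L \<union> (\<lambda>(\<phi>, x). skolem M d \<phi> x) ` (\<F> \<times> UNIV)
    \<union> (\<lambda>(\<phi>, x, k). enum M d \<phi> x k) ` (\<F> \<times> UNIV \<times> UNIV)"
  have "countable H"
    unfolding H_def using L \<F> by (auto simp: countable_language_def)
  moreover have "H \<noteq> {}"
    unfolding H_def \<F>_def by (auto intro: exI[of _ Falsum])
  ultimately obtain h :: "nat \<Rightarrow> 'a list \<Rightarrow> 'a" where h: "range h = H"
    by (metis range_from_nat_into)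
  \<comment> \<open>Three kinds of colours: the truth of a formula, the countability of its solution
    set, and the index of the head of the list in the enumeration with the tail as
    parameters.\<close>
  define \<C> where "\<C> = (\<lambda>\<phi> as. of_bool (sat M (env d as) \<phi>)) ` \<F>
    \<union> (\<lambda>(\<phi>, x) as. of_bool (countable (solutions M \<phi> x (env d as)))) ` (\<F> \<times> UNIV)
    \<union> (\<lambda>(\<phi>, x) as. LEAST k. hd as = enum M d \<phi> x k (tl as)) ` (\<F> \<times> UNIV)"
  have "countable \<C>"
    unfolding \<C>_def using \<F> by auto
  then obtain F :: "('i \<Rightarrow> 'a) filter" where F: "F \<noteq> bot" "\<forall>\<^sub>F \<rho> in F. range \<rho> \<subseteq> univ M"
    "\<forall>i j. i \<noteq> j \<longrightarrow> (\<forall>\<^sub>F \<rho> in F. \<rho> i \<noteq> \<rho> j)"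
    and const: "\<forall>c\<in>\<C>. \<forall>ts. \<exists>v. \<forall>\<^sub>F \<rho> in F. c (map (hval h \<rho>) ts) = v"
    using indiscernible_hterm_filter[OF _ assms(3), of \<C> h, where ?'i = 'i]
    by (elim meta_impE exE conjE) (assumption | rule that)+
  obtain g :: "'i hterm \<Rightarrow> 'i" where g: "inj g"
    using ex_inj_hterm[OF assms(4)] by blast
  \<comment> \<open>The choice depends only on which terms eventually equal \<open>t\<close>, so
    \<open>cls\<close> is constant on classes; \<open>g\<close> codes the chosen representative in
    \<open>'i\<close>.\<close>
  define cls where "cls t = g (SOME s. \<forall>\<^sub>F \<rho> in F. hval h \<rho> s = hval h \<rho> t)" for t
  have cls: "cls s = cls t \<longleftrightarrow> (\<forall>\<^sub>F \<rho> in F. hval h \<rho> s = hval h \<rho> t)" for s t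
  proof
    have some: "\<forall>\<^sub>F \<rho> in F. hval h \<rho> (SOME s. \<forall>\<^sub>F \<rho> in F. hval h \<rho> s = hval h \<rho> t) = hval h \<rho> t"
      for t
      by (rule someI[of _ t]) simp
    assume "cls s = cls t"
    then have "(SOME u. \<forall>\<^sub>F \<rho> in F. hval h \<rho> u = hval h \<rho> s) =
        (SOME u. \<forall>\<^sub>F \<rho> in F. hval h \<rho> u = hval h \<rho> t)"
      using g unfolding cls_def by (rule injD[rotated])
    with some[of s] some[of t] show "\<forall>\<^sub>F \<rho> in F. hval h \<rho> s = hval h \<rho> t"
      by (auto elim: eventually_elim2)
  next
    assume "\<forall>\<^sub>F \<rho> in F. hval h \<rho> s = hval h \<rho> t"
    then have "(\<forall>\<^sub>F \<rho> in F. hval h \<rho> u = hval h \<rho> s) \<longleftrightarrow> (\<forall>\<^sub>F \<rho> in F. hval h \<rho> u = hval h \<rho> t)" for u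
      by (intro eventually_subst) (auto elim: eventually_mono)
    then show "cls s = cls t"
      by (simp add: cls_def)
  qed
  \<comment> \<open>Truth values serve as colours through the codes 0 and 1; constancy of the code
    gives constancy of the truth value.\<close>
  have of_bool: "\<exists>v. \<forall>\<^sub>F \<rho> in F. P \<rho> = v" if n: "\<exists>n. \<forall>\<^sub>F \<rho> in F. of_bool (P \<rho>) = (n :: nat)" for P
  proof -
    obtain n :: nat where "\<forall>\<^sub>F \<rho> in F. of_bool (P \<rho>) = n"
      using n by blast
    then have "\<forall>\<^sub>F \<rho> in F. P \<rho> = (n = 1)"
      by eventually_elim (auto split: if_splits simp: of_bool_def)
    then show ?thesis
      by blast
  qed
  have "limit_hull L M d h F cls"
  proof
    fix k as
    have "h k \<in> H"
      using h by blast
    then show "h k as \<in> univ M"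
      unfolding H_def using M d by (auto simp: guarded_fint_in skolem_in enum_in)
  next
    fix f assume "f \<in> funs L"
    then have "guarded_fint L M d f \<in> range h"
      unfolding h H_def by blast
    then show "\<exists>k. h k = guarded_fint L M d f"
      by (auto simp: image_iff)
  next
    fix \<phi> x assume "wf_form L \<phi>"
    then have "skolem M d \<phi> x \<in> range h"
      unfolding h H_def \<F>_def by (intro UnI1[OF UnI2] image_eqI[of _ _ "(\<phi>, x)"]) simp_all
    then show "\<exists>k. h k = skolem M d \<phi> x"
      by (auto simp: image_iff)
  next
    fix \<phi> x k assume "wf_form L \<phi>"
    then have "enum M d \<phi> x k \<in> range h"
      unfolding h H_def \<F>_def by (intro UnI2 image_eqI[of _ _ "(\<phi>, x, k)"]) simp_all
    then show "\<exists>l. h l = enum M d \<phi> x k"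
      by (auto simp: image_iff)
  next
    fix \<phi> ts assume "wf_form L \<phi>"
    then have "(\<lambda>as. of_bool (sat M (env d as) \<phi>)) \<in> \<C>"
      unfolding \<C>_def \<F>_def by blast
    from const[rule_format, OF this, of ts]
    show "\<exists>v. \<forall>\<^sub>F \<rho> in F. sat M (env d (map (hval h \<rho>) ts)) \<phi> = v"
      by (rule of_bool)
  next
    fix \<phi> x ts assume "wf_form L \<phi>"
    then have "(\<lambda>as. of_bool (countable (solutions M \<phi> x (env d as)))) \<in> \<C>"
      unfolding \<C>_def \<F>_def by (intro UnI1[OF UnI2] image_eqI[of _ _ "(\<phi>, x)"]) simp_all
    from const[rule_format, OF this, of ts]
    show "\<exists>v. \<forall>\<^sub>F \<rho> in F. countable (solutions M \<phi> x (env d (map (hval h \<rho>) ts))) = v"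
      by (rule of_bool)
  next
    fix \<phi> t x ts assume "wf_form L \<phi>"
    then have "(\<lambda>as. LEAST k. hd as = enum M d \<phi> x k (tl as)) \<in> \<C>"
      unfolding \<C>_def \<F>_def by (intro UnI2 image_eqI[of _ _ "(\<phi>, x)"]) simp_all
    from const[rule_format, OF this, of "t # ts"]
    show "\<exists>v. \<forall>\<^sub>F \<rho> in F. (LEAST k. hval h \<rho> t = enum M d \<phi> x k (map (hval h \<rho>) ts)) = v"
      by simp
  qed (use F cls in auto)
  then show ?thesis
    by blast
qed

theorem theorem4p5:
  fixes L :: "('f, 'r) language"
    and T :: "('f, 'r) form set"
    and M :: "('f, 'r, 'a) struct"
  assumes "countable_language L"
    and "complete_theory TYPE('a) L T"
    and "is_model L T M"
    and "quasiminimal L M"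
    and "has_card_beth omega1 (univ M)"
  shows "\<forall>\<kappa> :: 'k rel. Card_order \<kappa> \<longrightarrow>
    (\<exists>N :: ('f, 'r, (nat + 'k) set) struct.
       is_model L T N \<and> quasiminimal L N \<and> \<kappa> \<le>o |univ N| )"
proof (intro allI impI)
  fix \<kappa> :: "'k rel"
  assume \<kappa>: "Card_order \<kappa>"
  \<comment> \<open>The generators are indexed by \<open>(nat + 'k) set\<close>: the summand
    \<open>nat\<close> and Cantor's theorem make this type uncountable, the summand
    \<open>'k\<close> makes it at least as large as \<kappa>.\<close>
  have UNIV_less: "|UNIV :: (nat + 'k) set| <o |UNIV :: (nat + 'k) set set|"
    using card_of_Pow[of "UNIV :: (nat + 'k) set"] by simp
  have uncountable: "\<not> countable (UNIV :: (nat + 'k) set set)"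
  proof
    assume "countable (UNIV :: (nat + 'k) set set)"
    then have "|UNIV :: (nat + 'k) set set| \<le>o natLeq"
      by (simp only: countable_card_le_natLeq)
    also have "natLeq \<le>o |UNIV :: (nat + 'k) set|"
      using infinite_iff_natLeq_ordLeq[of "UNIV :: (nat + 'k) set"] by simp
    finally show False
      using not_ordLess_ordLeq[OF UNIV_less] by blast
  qed
  then have "infinite (UNIV :: (nat + 'k) set set)"
    using countable_finite by blast
  then obtain d h F and cls :: "(nat + 'k) set hterm \<Rightarrow> (nat + 'k) set"
    where "limit_hull L M d h F cls"
    using ex_limit_hull[OF assms(1) _ assms(5)] assms(3) unfolding is_model_def by blast
  then interpret limit_hull L M d h F cls .
  have "\<kappa> =o |Field \<kappa>|"
    using card_of_Field_ordIso[OF \<kappa>] by (rule ordIso_symmetric)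
  also have "|Field \<kappa>| \<le>o |UNIV :: (nat + 'k) set|"
    using card_of_ordLeq[of "Field \<kappa>" "UNIV :: (nat + 'k) set"] by (auto intro: inj_Inr)
  also have "|UNIV :: (nat + 'k) set| \<le>o |UNIV :: (nat + 'k) set set|"
    using UNIV_less by (rule ordLess_imp_ordLeq)
  also have "|UNIV :: (nat + 'k) set set| \<le>o |univ limit_struct|"
    by (rule card_univ_limit_struct)
  finally have "\<kappa> \<le>o |univ limit_struct|" .
  moreover have "is_model L T limit_struct"
    using assms(2,3) by (intro is_model_limit_struct) (simp_all add: complete_theory_def)
  moreover have "quasiminimal L limit_struct"
    using assms(4) uncountable by (rule quasiminimal_limit_struct)
  ultimately show "\<exists>N :: ('f, 'r, (nat + 'k) set) struct.
      is_model L T N \<and> quasiminimal L N \<and> \<kappa> \<le>o |univ N|"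
    by blast
qed

end
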